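(* Let $\mathcal N$ be a quantum channel from $\mathcal L(A)$ to $\mathcal L(B)$ and let $0\le\epsilon<1$. Then $$C^{(1)}_{\mathrm{NS}}(\mathcal N,\epsilon)\le R_{\mathrm E}(\mathcal N,\epsilon)=\max_{\rho_A}\min_{\sigma_B}D_H^\epsilon\big((\mathrm{id}_{A'}\otimes\mathcal N)(\rho_{A'A})\,\big\|\,\rho_{A'}\otimes\sigma_B\big),$$ $$C^{(1)}_{\mathrm{NS}\cap\mathrm{PPT}}(\mathcal N,\epsilon)\le R_{\mathrm E\cap\mathrm{PPT}}(\mathcal N,\epsilon)=\max_{\rho_A}\min_{\sigma_B}D_{H,\mathrm{PPT}}^\epsilon\big((\mathrm{id}_{A'}\otimes\mathcal N)(\rho_{A'A})\,\big\|\,\rho_{A'}\otimes\sigma_B\big).$$ Moreover, both inequalities can be strict: there are amplitude damping channels $\mathcal N_\gamma^{AD}$ and error thresholds $\epsilon$ for which the first inequality is strict, and likewise for the second; and there are classical-quantum channels $\mathcal N_a^{cq}$ and error thresholds $\epsilon$ for which the first inequality is strict, and likewise for the second.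
   Context: All Hilbert spaces are finite-dimensional, $A'\cong A$, $\log$ is base 2. $J_{\mathcal N}=\sum_{i,j}|i\rangle\langle j|\otimes\mathcal N(|i\rangle\langle j|)\in\mathcal L(A\otimes B)$ is the Choi matrix of $\mathcal N$, and $T_B$ is the partial transpose on $B$. One-shot capacities (assisted by no-signalling and PPT-preserving codes, resp. no-signalling codes): $$C^{(1)}_{\mathrm{NS}\cap\mathrm{PPT}}(\mathcal N,\epsilon)=-\log\min\{\eta:\ 0\le F_{AB}\le\rho_A\otimes\mathbb 1_B,\ \operatorname{Tr}\rho_A=1,\ \operatorname{Tr}_AF_{AB}=\eta\mathbb 1_B,\ \operatorname{Tr}J_{\mathcal N}F_{AB}\ge1-\epsilon,\ 0\le F_{AB}^{T_B}\le\rho_A\otimes\mathbb 1_B\},$$ and $C^{(1)}_{\mathrm{NS}}(\mathcal N,\epsilon)$ is the same without the last constraint. Hypothesis testing quantities: $D_H^\epsilon(\rho_0\|\rho_1)=-\log\min\{\operatorname{Tr}T\rho_1:\ 1-\operatorname{Tr}T\rho_0\le\epsilon,\ 0\le T\le\mathbb 1\}$; for bipartite $A'B$ states, $D_{H,\mathrm{PPT}}^\epsilon$ is the same with the additional constraint $0\le T^{T_B}\le\mathbb 1$. In the max-min, $\rho_A$ and $\sigma_B$ range over density operators on $A$ and $B$, $\rho_{A'A}=(\mathbb 1_{A'}\otimes\rho_A^{1/2})\Phi_{A'A}(\mathbb 1_{A'}\otimes\rho_A^{1/2})$ with $\Phi_{A'A}=\sum_{i,j}|ii\rangle\langle jj|$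 is a purification of $\rho_A$, and $\rho_{A'}=\operatorname{Tr}_A\rho_{A'A}$. The quantities $R_{\mathrm E}$ and $R_{\mathrm E\cap\mathrm{PPT}}$ are defined by these max-min expressions; by a result of Matthews and Wehner they equal the semidefinite programs obtained from those for $C^{(1)}_{\mathrm{NS}}$ and $C^{(1)}_{\mathrm{NS}\cap\mathrm{PPT}}$, respectively, by replacing the constraint $\operatorname{Tr}_AF_{AB}=\eta\mathbb 1_B$ with $\operatorname{Tr}_AF_{AB}\le\eta\mathbb 1_B$. Amplitude damping channel: $\mathcal N_\gamma^{AD}(\rho)=E_0\rho E_0^\dagger+E_1\rho E_1^\dagger$ on a qubit, $0\le\gamma\le1$, $E_0=|0\rangle\langle0|+\sqrt{1-\gamma}|1\rangle\langle1|$, $E_1=\sqrt\gamma|0\rangle\langle1|$. Classical-quantum channel: $\mathcal N_a^{cq}(\rho)=\sum_{x=0}^1\langle x|\rho|x\rangle\,|\psi_x\rangle\langle\psi_x|$ with $|\psi_0\rangle=a|0\rangle+b|1\rangle$, $|\psi_1\rangle=a|0\rangle-b|1\rangle$, $a\ge b=\sqrt{1-a^2}$. *)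

theory Defs
  imports "HOL-Analysis.Analysis"
begin

text \<open>
  Operators on a finite-dimensional Hilbert space with a fixed orthonormal basis indexed by a
  finite type \<open>'n\<close> are complex matrices; the tensor product of the spaces indexed by \<open>'a\<close>
  and \<open>'b\<close> is the space indexed by \<open>'a \<times> 'b\<close>.
\<close>

type_synonym 'n op = "complex ^ 'n ^ 'n"

definition dagger :: "complex ^ 'm ^ 'n \<Rightarrow> complex ^ 'n ^ 'm"
  where "dagger X = (\<chi> i j. cnj (X $ j $ i))"

definition ket :: "'n::finite \<Rightarrow> complex ^ 'n"
  where "ket i = axis i 1"

definition ketbra :: "complex ^ 'm \<Rightarrow> complex ^ 'n \<Rightarrow> complex ^ 'n ^ 'm"
  where "ketbra u v = (\<chi> i j. u $ i * cnj (v $ j))"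

definition op_scale :: "complex \<Rightarrow> 'n::finite op \<Rightarrow> 'n op"
  where "op_scale c X = map_matrix ((*) c) X"

definition tensor_op :: "'a::finite op \<Rightarrow> 'b::finite op \<Rightarrow> ('a \<times> 'b) op"  (infixr "\<otimes>\<^sub>o" 75)
  where "X \<otimes>\<^sub>o Y = (\<chi> p q. X $ fst p $ fst q * Y $ snd p $ snd q)"

definition ptrace_fst :: "('a::finite \<times> 'b::finite) op \<Rightarrow> 'b op"
  where "ptrace_fst X = (\<chi> k l. \<Sum>i\<in>UNIV. X $ (i, k) $ (i, l))"

definition ptrace_snd :: "('a::finite \<times> 'b::finite) op \<Rightarrow> 'a op"
  where "ptrace_snd X = (\<chi> i j. \<Sum>k\<in>UNIV. X $ (i, k) $ (j, k))"

definition ptranspose_snd :: "('a::finite \<times> 'b::finite) op \<Rightarrow> ('a \<times> 'b) op"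
  where "ptranspose_snd X = (\<chi> p q. X $ (fst p, snd q) $ (fst q, snd p))"

text \<open>
  In the order on \<^typ>\<open>complex\<close>, \<open>0 \<le> z\<close> says that \<open>z\<close> is real and nonnegative, so
  Hermiticity is implied. The order \<open>\<le>\<close> on matrices is entrywise, hence the separate symbol
  for the operator order.
\<close>

definition psd :: "'n::finite op \<Rightarrow> bool"
  where "psd X \<longleftrightarrow> (\<forall>v. 0 \<le> (\<Sum>i\<in>UNIV. \<Sum>j\<in>UNIV. cnj (v $ i) * X $ i $ j * v $ j))"

definition op_le :: "'n::finite op \<Rightarrow> 'n op \<Rightarrow> bool"  (infix "\<preceq>" 50)
  where "X \<preceq> Y \<longleftrightarrow> psd (Y - X)"

definition density_ops :: "'n::finite op set"
  where "density_ops = {\<rho>. psd \<rho> \<and> trace \<rho> = 1}"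

definition op_sqrt :: "'n::finite op \<Rightarrow> 'n op"
  where "op_sqrt X = (THE S. psd S \<and> S ** S = X)"

text \<open>
  An \<open>n \<times> n\<close> block matrix \<open>X\<close> stands for the operator
  \<open>\<Sum>i,j<n. |i\<rangle>\<langle>j| \<otimes> X i j\<close> on the tensor product of an \<open>n\<close>-dimensional space with
  the given one, and applying \<open>N\<close> to every block is \<open>id\<^sub>n \<otimes> N\<close>; only the blocks with
  \<open>i, j < n\<close> matter. Complete positivity is positivity of \<open>id\<^sub>n \<otimes> N\<close> for every \<open>n\<close>.
\<close>

definition block_psd :: "nat \<Rightarrow> (nat \<Rightarrow> nat \<Rightarrow> 'n::finite op) \<Rightarrow> bool"
  where "block_psd n X \<longleftrightarrow> (\<forall>v. 0 \<le> (\<Sum>i<n. \<Sum>j<n. \<Sum>k\<in>UNIV. \<Sum>l\<in>UNIV.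
            cnj (v i $ k) * X i j $ k $ l * v j $ l))"
  for v :: "nat \<Rightarrow> complex ^ 'n"

definition completely_positive :: "('a::finite op \<Rightarrow> 'b::finite op) \<Rightarrow> bool"
  where "completely_positive N \<longleftrightarrow>
           (\<forall>n X. block_psd n X \<longrightarrow> block_psd n (\<lambda>i j. N (X i j)))"

definition quantum_channel :: "('a::finite op \<Rightarrow> 'b::finite op) \<Rightarrow> bool"
  where "quantum_channel N \<longleftrightarrow>
           (\<forall>X Y. N (X + Y) = N X + N Y) \<and> (\<forall>c X. N (op_scale c X) = op_scale c (N X)) \<and>
           completely_positive N \<and> (\<forall>X. trace (N X) = trace X)"

definition id_tensor :: "('a::finite op \<Rightarrow> 'b::finite op) \<Rightarrow> ('r::finite \<times> 'a) op \<Rightarrow> ('r \<times> 'b) op"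
  where "id_tensor N X =
           (\<chi> p q. N (\<chi> k l. X $ (fst p, k) $ (fst q, l)) $ snd p $ snd q)"

definition choi :: "('a::finite op \<Rightarrow> 'b::finite op) \<Rightarrow> ('a \<times> 'b) op"
  where "choi N = (\<Sum>i\<in>UNIV. \<Sum>j\<in>UNIV. ketbra (ket i) (ket j) \<otimes>\<^sub>o N (ketbra (ket i) (ket j)))"

text \<open>
  The minima in the optimisation problems below are written as infima: for a channel and
  \<open>0 \<le> \<epsilon> < 1\<close> the feasible sets are nonempty and compact, so the infimum is the minimum.
  The value \<open>0\<close> does occur in hypothesis testing, with the convention \<open>-log 0 = \<infinity>\<close>.
\<close>

definition neg_log2 :: "real \<Rightarrow> ereal"
  where "neg_log2 x = (if x \<le> 0 then \<infinity> else ereal (- log 2 x))"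

definition ns_feasible ::
  "('a::finite op \<Rightarrow> 'b::finite op) \<Rightarrow> real \<Rightarrow> ('a \<times> 'b) op \<Rightarrow> 'a op \<Rightarrow> real \<Rightarrow> bool"
  where "ns_feasible N \<epsilon> F \<rho> \<eta> \<longleftrightarrow>
           0 \<preceq> F \<and> F \<preceq> \<rho> \<otimes>\<^sub>o mat 1 \<and> trace \<rho> = 1 \<and>
           ptrace_fst F = mat (complex_of_real \<eta>) \<and>
           1 - \<epsilon> \<le> Re (trace (choi N ** F))"

definition C_NS :: "('a::finite op \<Rightarrow> 'b::finite op) \<Rightarrow> real \<Rightarrow> ereal"
  where "C_NS N \<epsilon> = neg_log2 (Inf {\<eta>. \<exists>F \<rho>. ns_feasible N \<epsilon> F \<rho> \<eta>})"

definition C_NS_PPT :: "('a::finite op \<Rightarrow> 'b::finite op) \<Rightarrow> real \<Rightarrow> ereal"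
  where "C_NS_PPT N \<epsilon> = neg_log2 (Inf {\<eta>. \<exists>F \<rho>. ns_feasible N \<epsilon> F \<rho> \<eta> \<and>
           0 \<preceq> ptranspose_snd F \<and> ptranspose_snd F \<preceq> \<rho> \<otimes>\<^sub>o mat 1})"

definition D_H :: "real \<Rightarrow> 'n::finite op \<Rightarrow> 'n op \<Rightarrow> ereal"
  where "D_H \<epsilon> \<rho>\<^sub>0 \<rho>\<^sub>1 = neg_log2 (Inf {Re (trace (T ** \<rho>\<^sub>1)) | T.
           1 - Re (trace (T ** \<rho>\<^sub>0)) \<le> \<epsilon> \<and> 0 \<preceq> T \<and> T \<preceq> mat 1})"

definition D_H_PPT :: "real \<Rightarrow> ('a::finite \<times> 'b::finite) op \<Rightarrow> ('a \<times> 'b) op \<Rightarrow> ereal"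
  where "D_H_PPT \<epsilon> \<rho>\<^sub>0 \<rho>\<^sub>1 = neg_log2 (Inf {Re (trace (T ** \<rho>\<^sub>1)) | T.
           1 - Re (trace (T ** \<rho>\<^sub>0)) \<le> \<epsilon> \<and> 0 \<preceq> T \<and> T \<preceq> mat 1 \<and>
           0 \<preceq> ptranspose_snd T \<and> ptranspose_snd T \<preceq> mat 1})"

definition max_ent :: "('a::finite \<times> 'a) op"
  where "max_ent = (\<Sum>i\<in>UNIV. \<Sum>j\<in>UNIV. ketbra (ket (i, i)) (ket (j, j)))"

definition purif :: "'a::finite op \<Rightarrow> ('a \<times> 'a) op"
  where "purif \<rho> = (mat 1 \<otimes>\<^sub>o op_sqrt \<rho>) ** max_ent ** (mat 1 \<otimes>\<^sub>o op_sqrt \<rho>)"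

definition R_E :: "('a::finite op \<Rightarrow> 'b::finite op) \<Rightarrow> real \<Rightarrow> ereal"
  where "R_E N \<epsilon> = (SUP \<rho>\<in>density_ops. INF \<sigma>\<in>density_ops.
           D_H \<epsilon> (id_tensor N (purif \<rho>)) (ptrace_snd (purif \<rho>) \<otimes>\<^sub>o \<sigma>))"

definition R_E_PPT :: "('a::finite op \<Rightarrow> 'b::finite op) \<Rightarrow> real \<Rightarrow> ereal"
  where "R_E_PPT N \<epsilon> = (SUP \<rho>\<in>density_ops. INF \<sigma>\<in>density_ops.
           D_H_PPT \<epsilon> (id_tensor N (purif \<rho>)) (ptrace_snd (purif \<rho>) \<otimes>\<^sub>o \<sigma>))"

text \<open>
  \<open>is_maxmin S T f m\<close>: all the inner minima and the outer maximum are attained, and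
  \<open>m\<close> is \<open>max\<^sub>s min\<^sub>t f s t\<close>.
\<close>

definition is_maxmin :: "'s set \<Rightarrow> 't set \<Rightarrow> ('s \<Rightarrow> 't \<Rightarrow> 'v::order) \<Rightarrow> 'v \<Rightarrow> bool"
  where "is_maxmin S T f m \<longleftrightarrow> (\<exists>g.
           (\<forall>s\<in>S. g s \<in> f s ` T \<and> (\<forall>t\<in>T. g s \<le> f s t)) \<and>
           m \<in> g ` S \<and> (\<forall>s\<in>S. g s \<le> m))"

text \<open>Qubits are indexed by the two-element type \<open>2\<close>, whose elements are \<open>0\<close> and \<open>1\<close>.\<close>

definition AD_channel :: "real \<Rightarrow> 2 op \<Rightarrow> 2 op"
  where "AD_channel \<gamma> \<rho> =
           (let E\<^sub>0 = ketbra (ket 0) (ket 0) + op_scale (of_real (sqrt (1 - \<gamma>))) (ketbra (ket 1) (ket 1));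
                E\<^sub>1 = op_scale (of_real (sqrt \<gamma>)) (ketbra (ket 0) (ket 1))
            in E\<^sub>0 ** \<rho> ** dagger E\<^sub>0 + E\<^sub>1 ** \<rho> ** dagger E\<^sub>1)"

definition cq_channel :: "real \<Rightarrow> 2 op \<Rightarrow> 2 op"
  where "cq_channel a \<rho> =
           (let b = sqrt (1 - a\<^sup>2);
                \<psi>\<^sub>0 = of_real a *s ket 0 + of_real b *s ket 1;
                \<psi>\<^sub>1 = of_real a *s ket 0 - of_real b *s ket 1
            in op_scale (\<rho> $ 0 $ 0) (ketbra \<psi>\<^sub>0 \<psi>\<^sub>0) + op_scale (\<rho> $ 1 $ 1) (ketbra \<psi>\<^sub>1 \<psi>\<^sub>1))"

end

theory Submission
  imports Defs
begin

text \<open>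
  Write \<open>\<omega>\<close> for the transpose of \<open>\<rho>\<^sub>A\<close>. Then the output state is
  \<open>(\<omega>\<^sup>1\<^sup>/\<^sup>2 \<otimes> 1) J (\<omega>\<^sup>1\<^sup>/\<^sup>2 \<otimes> 1)\<close>, and \<open>F = (\<omega>\<^sup>1\<^sup>/\<^sup>2 \<otimes> 1) T (\<omega>\<^sup>1\<^sup>/\<^sup>2 \<otimes> 1)\<close> turns
  tests \<open>T\<close> into operators \<open>0 \<le> F \<le> \<omega> \<otimes> 1\<close> with the same success probability and with
  \<open>Tr T(\<omega> \<otimes> \<sigma>) = Tr F(1 \<otimes> \<sigma>)\<close>. So a code with \<open>Tr\<^sub>A F \<le> \<eta> 1\<close> bounds the max-min expression from below
  by \<open>- log \<eta>\<close>, whatever \<open>\<sigma>\<close> is. The pairs \<open>(\<rho>, F)\<close> form a compact set, hence the extrema are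
  attained.

  For strictness, put \<open>G = \<omega> \<otimes> 1 - F\<close>: codes need \<open>Tr\<^sub>A G = (1 - \<eta>) 1\<close>, while the max-min
  only needs \<open>Tr\<^sub>A G \<ge> (1 - \<eta>) 1\<close>. At \<open>\<epsilon> = 0\<close> the operator \<open>G\<close> annihilates the range of
  \<open>J\<close>, and for both channels this makes the diagonal of \<open>Tr\<^sub>A G\<close> unbalanced unless
  \<open>Tr\<^sub>A G = 0\<close>. For the amplitude damping channel with the PPT constraint no
  such \<open>G\<close> has \<open>Tr\<^sub>A G > 0\<close>. There one takes a small \<open>\<epsilon>\<close>: the constraint bounds the coherence between
  \<open>|00\<rangle>\<close> and \<open>|11\<rangle>\<close> by the weights of \<open>G\<close> at \<open>|10\<rangle>\<close>, which is of order \<open>\<epsilon>\<close>, and at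
  \<open>|01\<rangle>\<close>, which is at most \<open>1 - \<eta>\<close> under the equality but may be of order 1 under the inequality. So
  \<open>1 - \<eta>\<close> is of order \<open>\<epsilon>\<close> in the first case and of order \<open>\<epsilon>\<^sup>1\<^sup>/\<^sup>2\<close> in the second.
\<close>

subsection \<open>Positive operators and the spectral theorem\<close>

text \<open>Conjugate linear in the first slot. Its real part is the Euclidean \<open>inner\<close>
  (\<open>Re_cip\<close>), which gives access to norms, orthogonality and the real Cauchy-Schwarz
  inequality.\<close>

definition cip :: "complex ^ 'n \<Rightarrow> complex ^ 'n::finite \<Rightarrow> complex"
  where "cip u v = (\<Sum>i\<in>UNIV. cnj (u $ i) * v $ i)"

lemma cip_add_left: "cip (u + v) w = cip u w + cip v w"
  and cip_add_right: "cip w (u + v) = cip w u + cip w v"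
  and cip_diff_right: "cip w (u - v) = cip w u - cip w v"
  and cip_smult_left: "cip (c *s u) w = cnj c * cip u w"
  and cip_smult_right: "cip w (c *s u) = c * cip w u"
  by (simp_all add: cip_def algebra_simps sum.distrib sum_subtractf sum_distrib_left)

lemma cip_zero [simp]: "cip 0 u = 0" "cip u 0 = 0"
  by (simp_all add: cip_def)

lemma cip_sum_right: "cip w (\<Sum>x\<in>I. f x) = (\<Sum>x\<in>I. cip w (f x))"
  unfolding cip_def
  by (simp add: sum_distrib_left) (rule sum.swap)

lemma cip_commute: "cip u v = cnj (cip v u)"
  by (simp add: cip_def mult.commute)

lemma Re_cip: "Re (cip u v) = inner u v"
  by (simp add: cip_def inner_vec_def inner_complex_def)

lemma cip_self: "cip u u = of_real ((norm u)\<^sup>2)"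
proof (rule complex_eqI)
  show "Im (cip u u) = Im (complex_of_real ((norm u)\<^sup>2))"
    using cip_commute[of u u] by (metis Im_complex_of_real Reals_cnj_iff complex_is_Real_iff)
qed (simp add: Re_cip power2_norm_eq_inner)

lemma cip_eq_0_all: "u = 0" if "\<And>v. cip v u = 0"
  using that[of u] by (simp add: cip_self)

lemma cip_dagger: "cip u (X *v v) = cip (dagger X *v u) v"
  unfolding cip_def matrix_vector_mult_def dagger_def
  by (simp add: sum_distrib_left sum_distrib_right algebra_simps) (rule sum.swap)

lemma mvm_ket: "X *v ket j = column j X"
  by (simp add: ket_def axis_def matrix_vector_mult_def column_def if_distrib[of "\<lambda>x. _ * x"] cong: if_cong)

lemma cip_ket: "cip (ket i) (X *v ket j) = X $ i $ j"
  unfolding mvm_ket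
  by (simp add: cip_def ket_def axis_def column_def if_distrib[of cnj] if_distrib[of "\<lambda>x. x * _"] cong: if_cong)

lemma matrix_eq_cip: "X = Y" if "\<And>u v. cip u (X *v v) = cip u (Y *v v)"
  using that by (metis cip_ket vec_eq_iff)

lemma psd_iff: "psd X \<longleftrightarrow> (\<forall>v. 0 \<le> cip v (X *v v))"
  unfolding psd_def cip_def matrix_vector_mult_def
  by (simp add: sum_distrib_left algebra_simps)

lemma dagger_dagger [simp]: "dagger (dagger X) = X"
  by (simp add: dagger_def)

lemma dagger_mult: "dagger (X ** Y) = dagger Y ** dagger X"
  by (simp add: dagger_def matrix_matrix_mult_def vec_eq_iff mult.commute)

lemma cip_hermitian: "cip u (X *v v) = cip (X *v u) v" if "dagger X = X"
  by (metis cip_dagger that)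

text \<open>Polarisation: the quadratic form is real at u, v, u + v and u + i v. The sum u + v fixes
  the imaginary parts of the two cross terms, u + i v the real parts.\<close>

lemma psd_hermitian: "dagger X = X" if "psd X"
proof -
  have r: "Im (cip v (X *v v)) = 0" for v
    using that by (auto simp: psd_iff less_eq_complex_def)
  have *: "cip u (X *v v) = cnj (cip v (X *v u))" for u v
  proof -
    have "Im (cip u (X *v v)) + Im (cip v (X *v u)) = 0"
      using r[of "u + v"] r[of u] r[of v]
      by (simp add: matrix_vector_right_distrib cip_add_left cip_add_right)
    moreover have "Re (cip u (X *v v)) - Re (cip v (X *v u)) = 0"
      using r[of "u + \<i> *s v"] r[of u] r[of v]
      by (simp add: matrix_vector_right_distrib cip_add_left cip_add_right vector_scalar_commute
          vec.scale cip_smult_left cip_smult_right)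
    ultimately show ?thesis by (auto intro: complex_eqI)
  qed
  show ?thesis
    by (rule matrix_eq_cip) (metis * cip_commute cip_dagger dagger_dagger)
qed

lemma psd_add: "psd (X + Y)" if "psd X" "psd Y"
  using that by (simp add: psd_iff matrix_vector_mult_add_rdistrib cip_add_right)

lemma psd_0 [simp]: "psd 0"
  by (simp add: psd_iff)

lemma psd_one: "psd (mat 1)"
  by (simp add: psd_iff cip_self less_eq_complex_def)

lemma psd_sum: "psd (\<Sum>x\<in>I. f x)" if "\<And>x. x \<in> I \<Longrightarrow> psd (f x)"
  using that by (induction I rule: infinite_finite_induct) (auto intro: psd_add)

lemma psd_congruence: "psd (C ** X ** dagger C)" if "psd X"
proof -
  have "cip v ((C ** X ** dagger C) *v v) = cip (dagger C *v v) (X *v (dagger C *v v))" for v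
    using cip_dagger[of v C] by (simp add: matrix_vector_mul_assoc[symmetric])
  then show ?thesis using that by (simp add: psd_iff)
qed

lemma op_scale_mv: "op_scale c X *v v = c *s (X *v v)"
  by (simp add: op_scale_def map_matrix_def matrix_vector_mult_def vec_eq_iff sum_distrib_left mult.assoc)

lemma op_scale_nth [simp]: "op_scale c X $ i $ j = c * X $ i $ j"
  by (simp add: op_scale_def map_matrix_def)

lemma psd_scale: "psd (op_scale (of_real c) X)" if "psd X" "0 \<le> c"
  using that by (simp add: psd_iff op_scale_mv cip_smult_right less_eq_complex_def)

lemma ketbra_nth [simp]: "ketbra u v $ i $ j = u $ i * cnj (v $ j)"
  by (simp add: ketbra_def)

lemma ketbra_mv: "ketbra u v *v w = cip v w *s u"
  by (simp add: ketbra_def matrix_vector_mult_def cip_def vec_eq_iff sum_distrib_left sum_distrib_right algebra_simps)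

lemma psd_ketbra: "psd (ketbra u u)"
proof -
  have "cip u v * cip v u = of_real ((cmod (cip u v))\<^sup>2)" for v
    by (metis cip_commute complex_norm_square)
  then show ?thesis
    by (simp add: psd_iff ketbra_mv cip_smult_right less_eq_complex_def)
qed

text \<open>Positivity of \<open>X\<close> is assumed on the plane of \<open>v\<close> and \<open>w\<close> only, because
  the eigenvector argument below applies this on an invariant subspace.\<close>
lemma null_vector_orthogonal:
  assumes herm: "dagger X = X" and v: "cip v (X *v v) = 0"
    and pos: "\<And>c. 0 \<le> Re (cip (v + c *s w) (X *v (v + c *s w)))"
  shows "cip w (X *v v) = 0"
proof -
  define z where "z = cip w (X *v v)"
  define q where "q = Re (cip w (X *v w))"
  have z': "cip v (X *v w) = cnj z"
    using cip_hermitian[OF herm] by (metis cip_commute z_def)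
  \<comment> \<open>Moving from \<open>v\<close> along \<open>t * z\<close> times \<open>w\<close>
    aligns the phases, so the first-order term is real and equals 2 t |z|^2.\<close>
  have ineq: "0 \<le> 2 * t * (cmod z)\<^sup>2 + t\<^sup>2 * (cmod z)\<^sup>2 * q" for t :: real
  proof -
    have "cip (v + (of_real t * z) *s w) (X *v (v + (of_real t * z) *s w)) =
        2 * of_real t * (z * cnj z) + of_real (t\<^sup>2) * (z * cnj z) * cip w (X *v w)"
      by (simp add: matrix_vector_right_distrib cip_add_left cip_add_right vec.scale cip_smult_left
          cip_smult_right v z' z_def[symmetric] algebra_simps power2_eq_square)
    then have "Re (cip (v + (of_real t * z) *s w) (X *v (v + (of_real t * z) *s w))) =
        2 * t * (cmod z)\<^sup>2 + t\<^sup>2 * (cmod z)\<^sup>2 * q"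
      by (simp add: complex_norm_square[symmetric] q_def mult.assoc)
    with pos show ?thesis by metis
  qed
  have "(cmod z)\<^sup>2 = 0"
  proof (rule ccontr)
    assume "(cmod z)\<^sup>2 \<noteq> 0"
    then have p: "(cmod z)\<^sup>2 > 0" by simp
    \<comment> \<open>A negative \<open>t\<close> with |t q| at most 1 lets the linear term dominate
      the quadratic one, so the form would become negative.\<close>
    define t where "t = - 1 / (1 + \<bar>q\<bar>)"
    have t: "t < 0" by (simp add: t_def divide_neg_pos add_pos_nonneg)
    have "0 \<le> (t * (cmod z)\<^sup>2) * (2 + t * q)"
      using ineq[of t] by (simp add: algebra_simps power2_eq_square)
    moreover have "t * (cmod z)\<^sup>2 < 0" using t p by (rule mult_neg_pos)
    ultimately have "2 + t * q \<le> 0"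
      by (metis mult_neg_pos not_le)
    moreover have "\<bar>t * q\<bar> \<le> 1"
      by (simp add: t_def abs_mult divide_simps)
    ultimately show False by linarith
  qed
  then show ?thesis by (simp add: z_def)
qed

lemma psd_null: "X *v v = 0" if "psd X" "cip v (X *v v) = 0"
proof (rule cip_eq_0_all)
  fix w
  have "0 \<le> Re (cip u (X *v u))" for u
    using that(1) by (simp add: psd_iff less_eq_complex_def)
  then show "cip w (X *v v) = 0"
    using null_vector_orthogonal[OF psd_hermitian[OF that(1)] that(2)] by blast
qed

text \<open>Maximise the Rayleigh quotient over the unit sphere of \<open>V\<close>. With
  \<open>l\<close> the maximum, the form of l - X is nonnegative on \<open>V\<close> and vanishes at
  the maximiser \<open>v\<close>, so (l - X) v is orthogonal to \<open>V\<close>. By invariance it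
  also lies in \<open>V\<close>, hence it is zero.\<close>

lemma eigenvector_on_subspace:
  fixes X :: "'n::finite op" and V :: "(complex ^ 'n) set"
  assumes herm: "dagger X = X" and closed: "closed V" and w: "w \<in> V" "w \<noteq> 0"
    and add: "\<And>u v. u \<in> V \<Longrightarrow> v \<in> V \<Longrightarrow> u + v \<in> V"
    and scale: "\<And>c u. u \<in> V \<Longrightarrow> c *s u \<in> V"
    and inv: "\<And>u. u \<in> V \<Longrightarrow> X *v u \<in> V"
  obtains v l where "v \<in> V" "norm v = 1" "X *v v = of_real l *s v"
proof -
  let ?S = "V \<inter> sphere 0 1"
  let ?f = "\<lambda>v. Re (cip v (X *v v))"
  have nrm: "norm (of_real r *s u) = \<bar>r\<bar> * norm u" for r and u :: "complex ^ 'n"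
  proof -
    have "of_real r *s u = r *\<^sub>R u" by (simp add: vec_eq_iff scaleR_conv_of_real[symmetric] of_real_def)
    then show ?thesis by simp
  qed
  have "compact ?S" using closed by (simp add: closed_Int_compact)
  moreover have "of_real (1 / norm w) *s w \<in> ?S"
    using w nrm[of "1 / norm w" w] by (simp add: scale)
  moreover have "continuous_on ?S ?f"
    unfolding cip_def matrix_vector_mult_def by (intro continuous_intros)
  ultimately obtain v where v: "v \<in> ?S" "\<And>u. u \<in> ?S \<Longrightarrow> ?f u \<le> ?f v"
    using continuous_attains_sup[of ?S ?f] by blast
  have f_scale: "?f (of_real r *s u) = r * (r * ?f u)" for r u
    by (simp add: vec.scale cip_smult_left cip_smult_right)
  define l where "l = ?f v"
  have im: "Im (cip u (X *v u)) = 0" for u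
  proof -
    have "cip u (X *v u) = cnj (cip u (X *v u))"
      using cip_hermitian[OF herm, of u u] cip_commute by metis
    then show ?thesis by (metis Reals_cnj_iff complex_is_Real_iff)
  qed
  have max: "?f u \<le> l * (norm u)\<^sup>2" if "u \<in> V" for u
  proof (cases "u = 0")
    case False
    let ?r = "1 / norm u"
    have "of_real ?r *s u \<in> ?S" using False that nrm[of ?r u] by (simp add: scale)
    then have "?f (of_real ?r *s u) \<le> l" unfolding l_def by (rule v(2))
    then have "?r * (?r * ?f u) \<le> l" by (simp only: f_scale)
    with False show ?thesis by (simp add: field_simps power2_eq_square)
  qed simp
  define Y where "Y = mat (of_real l) - X"
  have matl: "mat (of_real l) *v u = of_real l *s u" for u :: "complex ^ 'n"
    by (simp add: mat_def matrix_vector_mult_def vec_eq_iff if_distrib[of "\<lambda>x. x * _"] cong: if_cong)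
  have Y: "Y *v u = of_real l *s u - X *v u" for u
    by (simp add: Y_def matrix_vector_mult_diff_rdistrib matl)
  have Yq: "cip u (Y *v u) = of_real (l * (norm u)\<^sup>2) - cip u (X *v u)" for u
    by (simp add: Y cip_diff_right cip_smult_right cip_self)
  have Yherm: "dagger Y = Y"
    using herm by (auto simp: Y_def dagger_def mat_def vec_eq_iff)
  have "cip v (Y *v v) = 0"
    using v(1) im[of v] by (auto simp: Yq l_def intro: complex_eqI)
  moreover have "0 \<le> Re (cip (v + c *s u) (Y *v (v + c *s u)))" if "u \<in> V" for u c
    using max[of "v + c *s u"] v(1) that by (simp add: Yq add scale)
  ultimately have "cip u (Y *v v) = 0" if "u \<in> V" for u
    using null_vector_orthogonal[OF Yherm] that by blast
  moreover have "Y *v v \<in> V"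
  proof -
    have "- 1 *s (X *v v) \<in> V" using v(1) inv scale by blast
    moreover have "of_real l *s v \<in> V" using v(1) scale by blast
    ultimately have "of_real l *s v + - 1 *s (X *v v) \<in> V" using add by blast
    moreover have "of_real l *s v + - 1 *s (X *v v) = Y *v v" by (simp add: Y)
    ultimately show ?thesis by simp
  qed
  ultimately have "cip (Y *v v) (Y *v v) = 0" by blast
  then have "Y *v v = 0" by (simp add: cip_self)
  then have "X *v v = of_real l *s v" by (simp add: Y)
  with v(1) that show ?thesis by auto
qed

section \<open>Orthonormal sets and diagonalisation\<close>

definition orthonormal :: "(complex ^ 'n::finite) set \<Rightarrow> bool"
  where "orthonormal B \<longleftrightarrow> (\<forall>u\<in>B. \<forall>v\<in>B. cip u v = (if u = v then 1 else 0))"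

text \<open>Complex orthonormality implies real orthogonality, hence real independence. The bound is
  the real dimension; it serves to make a largest orthonormal set of eigenvectors exist.\<close>

lemma orthonormal_finite_card:
  fixes B :: "(complex ^ 'n::finite) set"
  assumes "orthonormal B"
  shows "finite B \<and> card B \<le> DIM(complex ^ 'n)"
proof (rule independent_bound, rule pairwise_orthogonal_independent)
  show "pairwise orthogonal B"
    using assms by (auto simp: pairwise_def orthogonal_def orthonormal_def Re_cip[symmetric])
  show "0 \<notin> B"
  proof
    assume "0 \<in> B"
    then have "cip (0 :: complex ^ 'n) 0 = 1" using assms unfolding orthonormal_def by presburger
    then show False by simp
  qed
qed

theorem spectral:
  fixes X :: "'n::finite op"
  assumes herm: "dagger X = X"
  obtains B and l :: "complex ^ 'n \<Rightarrow> real" where "finite B" "orthonormal B"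
    "(mat 1 :: 'n op) = (\<Sum>u\<in>B. ketbra u u)" "\<And>u. u \<in> B \<Longrightarrow> X *v u = of_real (l u) *s u"
proof -
  \<comment> \<open>A largest orthonormal set of eigenvectors; its orthogonal complement is invariant, hence zero.\<close>
  define P where "P B \<longleftrightarrow> orthonormal B \<and> (\<forall>u\<in>B. \<exists>l::real. X *v u = of_real l *s u)" for B
  have P0: "P {}" by (simp add: P_def orthonormal_def)
  have "\<forall>B. P B \<longrightarrow> card B \<le> DIM(complex ^ 'n)"
    using orthonormal_finite_card P_def by blast
  then have "\<forall>B. P B \<longrightarrow> card B < Suc (DIM(complex ^ 'n))"
    by (simp add: less_Suc_eq_le)
  with P0 obtain B where B: "P B" "\<And>B'. P B' \<Longrightarrow> card B' \<le> card B"
    using ex_has_greatest_nat[of P "{}" card "Suc (DIM(complex ^ 'n))"] by blast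
  then have fin: "finite B" and on: "orthonormal B" using orthonormal_finite_card P_def by auto
  from B(1) obtain l where l: "\<And>u. u \<in> B \<Longrightarrow> X *v u = of_real (l u) *s u"
    unfolding P_def by metis
  define V where "V = {w. \<forall>u\<in>B. cip u w = 0}"
  have V0: "w = 0" if wV: "w \<in> V" for w
  proof (rule ccontr)
    assume "w \<noteq> 0"
    have clV: "closed V"
    proof -
      have "V = (\<Inter>u\<in>B. {w. cip u w = 0})" by (auto simp: V_def)
      also have "closed \<dots>" unfolding cip_def by (intro closed_INT ballI closed_Collect_eq continuous_intros)
      finally show ?thesis .
    qed
    obtain v k where v: "v \<in> V" "norm v = 1" "X *v v = of_real k *s v"
    proof (rule eigenvector_on_subspace[OF herm clV wV \<open>w \<noteq> 0\<close>])
      fix u assume u: "u \<in> V"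
      have "cip b (X *v u) = 0" if "b \<in> B" for b
        using that u by (simp add: cip_hermitian[OF herm] l cip_smult_left V_def)
      then show "X *v u \<in> V" by (simp add: V_def)
    qed (auto simp: V_def cip_add_right cip_smult_right)
    have vv: "cip v v = 1" using v by (simp add: cip_self)
    have vb: "cip u v = 0" "cip v u = 0" if "u \<in> B" for u
      using v that cip_commute[of v u] by (auto simp: V_def)
    have "v \<notin> B" using vb vv by fastforce
    have "P (insert v B)"
      using B(1) v(3) vv vb by (auto simp: P_def orthonormal_def)
    from B(2)[OF this] \<open>v \<notin> B\<close> fin show False by simp
  qed
  have "w = (\<Sum>u\<in>B. cip u w *s u)" for w
  proof -
    have "cip b (w - (\<Sum>u\<in>B. cip u w *s u)) = 0" if "b \<in> B" for b
    proof -
      have "(\<Sum>u\<in>B. cip u w * cip b u) = (\<Sum>u\<in>B. if u = b then cip b w else 0)"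
        using on that by (intro sum.cong) (auto simp: orthonormal_def)
      then show ?thesis
        using fin that by (simp add: cip_diff_right cip_sum_right cip_smult_right)
    qed
    then have "w - (\<Sum>u\<in>B. cip u w *s u) \<in> V" by (simp add: V_def)
    from V0[OF this] show ?thesis by simp
  qed
  then have "mat 1 *v w = (\<Sum>u\<in>B. ketbra u u) *v w" for w
  proof -
    have "(\<Sum>u\<in>B. ketbra u u) *v w = (\<Sum>u\<in>B. ketbra u u *v w)"
      using fin by (induction B rule: finite_induct) (auto simp: matrix_vector_mult_add_rdistrib)
    then show ?thesis using \<open>\<And>w. w = _ w\<close> by (simp add: ketbra_mv)
  qed
  then have "(mat 1 :: 'n op) = (\<Sum>u\<in>B. ketbra u u)" by (simp add: matrix_eq)
  from that[OF fin on this l] show ?thesis .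
qed

subsection \<open>Square roots\<close>

text \<open>Functional calculus: for an orthonormal basis \<open>B\<close> of eigenvectors,
  products, differences and square roots reduce to operations on the eigenvalue function
  \<open>f\<close>.\<close>

definition spectral_op :: "(complex ^ 'n::finite) set \<Rightarrow> (complex ^ 'n \<Rightarrow> real) \<Rightarrow> 'n op"
  where "spectral_op B f = (\<Sum>u\<in>B. op_scale (of_real (f u)) (ketbra u u))"

definition onb :: "(complex ^ 'n::finite) set \<Rightarrow> bool"
  where "onb B \<longleftrightarrow> finite B \<and> orthonormal B \<and> (mat 1 :: 'n op) = (\<Sum>u\<in>B. ketbra u u)"

lemma sum_matrix_vector: "(\<Sum>x\<in>I. f x) *v w = (\<Sum>x\<in>I. f x *v w)"
  by (induction I rule: infinite_finite_induct) (auto simp: matrix_vector_mult_add_rdistrib)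

lemma onb_expand:
  fixes w :: "complex ^ 'n::finite"
  assumes "onb B"
  shows "w = (\<Sum>u\<in>B. cip u w *s u)"
proof -
  have "w = mat 1 *v w" by simp
  also have "\<dots> = (\<Sum>u\<in>B. ketbra u u) *v w" using assms by (simp only: onb_def)
  also have "\<dots> = (\<Sum>u\<in>B. cip u w *s u)" by (simp add: sum_matrix_vector ketbra_mv)
  finally show ?thesis .
qed

lemma onb_ext:
  fixes X Y :: "'n::finite op"
  assumes B: "onb B" and eq: "\<And>u. u \<in> B \<Longrightarrow> X *v u = Y *v u"
  shows "X = Y"
proof -
  have *: "Z *v w = (\<Sum>u\<in>B. cip u w *s (Z *v u))" for Z :: "'n op" and w
  proof -
    have "Z *v w = Z *v (\<Sum>u\<in>B. cip u w *s u)" by (subst onb_expand[OF B, of w]) (rule refl)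
    also have "\<dots> = (\<Sum>u\<in>B. cip u w *s (Z *v u))"
      by (simp add: vec.linear_sum[OF matrix_vector_mul_linear_gen] vec.scale)
    finally show ?thesis .
  qed
  have "X *v w = Y *v w" for w
  proof -
    have "(\<Sum>u\<in>B. cip u w *s (X *v u)) = (\<Sum>u\<in>B. cip u w *s (Y *v u))"
      by (simp add: eq)
    then show ?thesis by (simp only: *[of X w] *[of Y w])
  qed
  then show ?thesis by (simp add: matrix_eq)
qed

lemma spectral_op_mv:
  assumes "onb B" "u \<in> B"
  shows "spectral_op B f *v u = of_real (f u) *s u"
proof -
  have "spectral_op B f *v u = (\<Sum>v\<in>B. (of_real (f v) * cip v u) *s v)"
    by (simp add: spectral_op_def sum_matrix_vector op_scale_mv ketbra_mv)
  also have "\<dots> = (\<Sum>v\<in>B. if v = u then of_real (f u) *s u else 0)"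
    using assms by (intro sum.cong) (auto simp: onb_def orthonormal_def)
  also have "\<dots> = of_real (f u) *s u" using assms by (simp add: onb_def)
  finally show ?thesis .
qed

lemma spectral_op_mult:
  "onb B \<Longrightarrow> spectral_op B f ** spectral_op B g = spectral_op B (\<lambda>u. f u * g u)"
  by (rule onb_ext) (auto simp: matrix_vector_mul_assoc[symmetric] spectral_op_mv vec.scale)

lemma spectral_op_diff:
  "onb B \<Longrightarrow> spectral_op B f - spectral_op B g = spectral_op B (\<lambda>u. f u - g u)"
  by (rule onb_ext) (auto simp: matrix_vector_mult_diff_rdistrib spectral_op_mv)

lemma spectral_op_one: "onb B \<Longrightarrow> mat 1 = spectral_op B (\<lambda>u. 1)"
  by (rule onb_ext) (auto simp: spectral_op_mv)

lemma psd_spectral_op: "(\<And>u. u \<in> B \<Longrightarrow> 0 \<le> f u) \<Longrightarrow> psd (spectral_op B f)"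
  unfolding spectral_op_def by (intro psd_sum psd_scale psd_ketbra)

lemma dagger_spectral_op: "dagger (spectral_op B f) = spectral_op B f"
  by (simp add: spectral_op_def dagger_def vec_eq_iff mult.commute)

lemma psd_spectral:
  fixes X :: "'n::finite op"
  assumes "psd X"
  obtains B l where "onb B" "X = spectral_op B l" "\<And>u. u \<in> B \<Longrightarrow> 0 \<le> l u"
proof -
  obtain B l where B: "onb B" and l: "\<And>u. u \<in> B \<Longrightarrow> X *v u = of_real (l u) *s u"
    using spectral[OF psd_hermitian[OF assms]] unfolding onb_def by metis
  have "X = spectral_op B l" by (rule onb_ext[OF B]) (simp add: l B spectral_op_mv)
  moreover have "0 \<le> l u" if "u \<in> B" for u
  proof -
    have "cip u u = 1" using B that by (simp add: onb_def orthonormal_def)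
    then have "cip u (X *v u) = of_real (l u)" by (simp add: l that cip_smult_right)
    moreover have "0 \<le> cip u (X *v u)" using assms by (simp add: psd_iff)
    ultimately show ?thesis by (simp add: less_eq_complex_def)
  qed
  ultimately show ?thesis using that B by blast
qed

text \<open>On an eigenvector u of S^2 with eigenvalue r^2 one has (S + r)(S - r) u = 0. For r > 0 a
  nonzero (S - r) u would be an eigenvector of S for -r, against positivity; for r = 0 the norm of S
  u vanishes.\<close>

lemma psd_sqrt_unique:
  fixes S :: "'n::finite op"
  assumes B: "onb B" and l: "\<And>u. u \<in> B \<Longrightarrow> 0 \<le> l u"
    and S: "psd S" "S ** S = spectral_op B l"
  shows "S = spectral_op B (\<lambda>u. sqrt (l u))"
proof (rule onb_ext[OF B])
  fix u assume u: "u \<in> B"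
  have SSu: "S *v (S *v u) = of_real (l u) *s u"
    using spectral_op_mv[OF B u, of l] by (simp add: matrix_vector_mul_assoc S)
  have "S *v u = of_real (sqrt (l u)) *s u"
  proof (cases "l u = 0")
    case True
    have "cip (S *v u) (S *v u) = cip u (S *v (S *v u))"
      by (simp add: cip_hermitian[OF psd_hermitian[OF S(1)]])
    then have "S *v u = 0" by (simp add: SSu True cip_self)
    then show ?thesis using True by simp
  next
    case False
    define r where "r = sqrt (l u)"
    have r: "0 < r" "r * r = l u" using False l[OF u] by (auto simp: r_def)
    define w where "w = S *v u - of_real r *s u"
    have "S *v w = of_real (- r) *s w"
      by (simp add: w_def matrix_vector_mult_diff_distrib vec.scale SSu r(2)[symmetric] vec_eq_iff algebra_simps)
    then have "cip w (S *v w) = of_real (- (r * (norm w)\<^sup>2))"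
      by (simp only: cip_smult_right cip_self) simp
    moreover have "0 \<le> cip w (S *v w)" using S(1) by (simp add: psd_iff)
    ultimately have "r * (norm w)\<^sup>2 \<le> 0" by (simp add: less_eq_complex_def)
    then have "w = 0" using r(1) by (simp add: mult_le_0_iff)
    then show ?thesis by (simp add: w_def r_def)
  qed
  then show "S *v u = spectral_op B (\<lambda>u. sqrt (l u)) *v u" by (simp add: spectral_op_mv B u)
qed

lemma op_sqrt_spectral:
  assumes B: "onb B" and l: "\<And>u. u \<in> B \<Longrightarrow> 0 \<le> l u"
  shows "op_sqrt (spectral_op B l) = spectral_op B (\<lambda>u. sqrt (l u))"
  unfolding op_sqrt_def
proof (rule the_equality)
  have "spectral_op B (\<lambda>u. sqrt (l u) * sqrt (l u)) = spectral_op B l"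
    unfolding spectral_op_def using l by (intro sum.cong) auto
  then show "psd (spectral_op B (\<lambda>u. sqrt (l u))) \<and>
      spectral_op B (\<lambda>u. sqrt (l u)) ** spectral_op B (\<lambda>u. sqrt (l u)) = spectral_op B l"
    using l by (auto simp: spectral_op_mult B intro: psd_spectral_op)
next
  fix S :: "'a op" assume "psd S \<and> S ** S = spectral_op B l"
  then show "S = spectral_op B (\<lambda>u. sqrt (l u))"
    by (intro psd_sqrt_unique[OF B l]) auto
qed

lemma op_sqrt_unique: "op_sqrt X = S" if "psd S" "S ** S = X"
proof -
  have "X = S ** mat 1 ** dagger S" using that psd_hermitian[OF that(1)] by simp
  then have "psd X" using psd_congruence psd_one by metis
  then obtain B l where B: "onb B" "X = spectral_op B l" "\<And>u. u \<in> B \<Longrightarrow> 0 \<le> l u"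
    using psd_spectral by blast
  then show ?thesis using that by (metis op_sqrt_spectral psd_sqrt_unique)
qed

lemma op_sqrt_psd: "psd (op_sqrt X)"
  and op_sqrt_sq: "op_sqrt X ** op_sqrt X = X" if X: "psd X"
proof -
  obtain B l where B: "onb B" "X = spectral_op B l" "\<And>u. u \<in> B \<Longrightarrow> 0 \<le> l u"
    using psd_spectral[OF X] by blast
  let ?S = "spectral_op B (\<lambda>u. sqrt (l u))"
  have "spectral_op B (\<lambda>u. sqrt (l u) * sqrt (l u)) = spectral_op B l"
    unfolding spectral_op_def using B by (intro sum.cong) auto
  then have "psd ?S" "?S ** ?S = X"
    using B by (auto simp: spectral_op_mult intro: psd_spectral_op)
  then show "psd (op_sqrt X)" "op_sqrt X ** op_sqrt X = X" by (auto simp: op_sqrt_unique)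
qed

lemma op_sqrt_pseudo_inverse:
  assumes "psd X"
  obtains R where "dagger R = R" "R ** op_sqrt X = op_sqrt X ** R"
    "op_sqrt X ** (R ** op_sqrt X) = op_sqrt X" "psd (mat 1 - R ** X ** R)"
proof -
  obtain B l where B: "onb B" "X = spectral_op B l" "\<And>u. u \<in> B \<Longrightarrow> 0 \<le> l u"
    using psd_spectral[OF assms] by blast
  have S: "op_sqrt X = spectral_op B (\<lambda>u. sqrt (l u))" using B by (simp add: op_sqrt_spectral)
  \<comment> \<open>Because 1 / 0 = 0, \<open>R\<close> inverts the square root on its support and
    vanishes on the kernel; \<open>R ** X ** R\<close> is then the support projection.\<close>
  define R where "R = spectral_op B (\<lambda>u. 1 / sqrt (l u))"
  have cong: "spectral_op B f = spectral_op B g" if "\<And>u. u \<in> B \<Longrightarrow> f u = g u" for f g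
    unfolding spectral_op_def using that by (intro sum.cong) auto
  show thesis
  proof (rule that[of R])
    show "dagger R = R" by (simp add: R_def dagger_spectral_op)
    show "R ** op_sqrt X = op_sqrt X ** R"
      by (simp add: S R_def spectral_op_mult B(1))
    show "op_sqrt X ** (R ** op_sqrt X) = op_sqrt X"
      unfolding S R_def spectral_op_mult[OF B(1)] by (rule cong) auto
    have "mat 1 - R ** X ** R = spectral_op B (\<lambda>u. 1 - 1 / sqrt (l u) * l u * (1 / sqrt (l u)))"
      unfolding spectral_op_one[OF B(1)] B(2) R_def
      by (simp only: spectral_op_mult[OF B(1)] spectral_op_diff[OF B(1)])
    also have "psd \<dots>"
    proof (rule psd_spectral_op)
      fix u assume "u \<in> B"
      then have "0 \<le> l u" using B by simp
      then show "0 \<le> 1 - 1 / sqrt (l u) * l u * (1 / sqrt (l u))"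
        by (cases "l u = 0") (auto simp: field_simps)
    qed
    finally show "psd (mat 1 - R ** X ** R)" .
  qed
qed

lemma psd_transpose: "psd (transpose X)" if "psd X"
proof -
  have "cip v (transpose X *v v) = cip (\<chi> i. cnj (v $ i)) (X *v (\<chi> i. cnj (v $ i)))" for v
    unfolding cip_def transpose_def matrix_vector_mult_def
    by (simp add: sum_distrib_left sum_distrib_right) (subst sum.swap, simp add: ac_simps)
  then show ?thesis using that by (simp add: psd_iff)
qed

lemma op_sqrt_transpose: "op_sqrt (transpose X) = transpose (op_sqrt X)" if "psd X"
  by (rule op_sqrt_unique)
     (simp_all add: psd_transpose op_sqrt_psd that matrix_transpose_mul[symmetric] op_sqrt_sq)

subsection \<open>Tensor products and the Choi matrix\<close>

lemma sum_prod_UNIV: "(\<Sum>p\<in>(UNIV :: ('a::finite \<times> 'b::finite) set). f p) = (\<Sum>i\<in>UNIV. \<Sum>j\<in>UNIV. f (i, j))"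
  by (simp add: sum.cartesian_product)

lemma tensor_nth [simp]: "(X \<otimes>\<^sub>o Y) $ p $ q = X $ fst p $ fst q * Y $ snd p $ snd q"
  by (simp add: tensor_op_def)

lemma mat_nth: "mat c $ i $ j = (if i = j then c else 0)"
  by (simp add: mat_def)

lemma tensor_mult: "(A \<otimes>\<^sub>o B) ** (C \<otimes>\<^sub>o D) = (A ** C) \<otimes>\<^sub>o (B ** D)"
  by (simp add: vec_eq_iff matrix_matrix_mult_def sum_prod_UNIV sum_product ac_simps)

lemma tensor_one: "mat 1 \<otimes>\<^sub>o mat 1 = mat 1"
  by (simp add: vec_eq_iff mat_nth prod_eq_iff)

lemma dagger_tensor: "dagger (A \<otimes>\<^sub>o B) = dagger A \<otimes>\<^sub>o dagger B"
  by (simp add: dagger_def vec_eq_iff)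

lemma tensor_diff_left: "(A - B) \<otimes>\<^sub>o C = A \<otimes>\<^sub>o C - B \<otimes>\<^sub>o C"
  by (simp add: vec_eq_iff algebra_simps)

lemma psd_square: "psd (S ** S)" if "dagger S = S"
  using psd_congruence[OF psd_one, of S] that by simp

text \<open>The tensor product of the square roots is a Hermitian square root of the tensor
  product.\<close>

lemma psd_tensor: "psd (A \<otimes>\<^sub>o B)" if "psd A" "psd B"
proof -
  let ?S = "op_sqrt A \<otimes>\<^sub>o op_sqrt B"
  have "psd (?S ** ?S)"
    by (rule psd_square) (simp add: dagger_tensor psd_hermitian op_sqrt_psd that)
  then show ?thesis by (simp add: tensor_mult op_sqrt_sq that)
qed

lemma psd_diag: "psd X \<Longrightarrow> 0 \<le> X $ i $ i"
  by (metis cip_ket psd_iff)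

lemma psd_trace: "psd X \<Longrightarrow> 0 \<le> trace X"
  by (simp add: trace_def psd_diag sum_nonneg)

lemma trace_psd_mult: "0 \<le> trace (X ** Y)" if "psd X" "psd Y"
proof -
  let ?S = "op_sqrt X"
  have "trace (X ** Y) = trace (?S ** (?S ** Y))"
    by (simp add: op_sqrt_sq that matrix_mul_assoc)
  also have "\<dots> = trace ((?S ** Y) ** dagger ?S)"
    by (subst trace_mul_sym) (simp add: psd_hermitian op_sqrt_psd that)
  finally show ?thesis using psd_trace psd_congruence that(2) by metis
qed

lemma tensor_one_mult_left_nth:
  "((A \<otimes>\<^sub>o mat 1) ** X) $ p $ q = (\<Sum>j\<in>UNIV. A $ fst p $ j * X $ (j, snd p) $ q)"
  by (simp add: matrix_matrix_mult_def sum_prod_UNIV mat_nth if_distrib[of "\<lambda>x. _ * x"]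
      if_distrib[of "\<lambda>x. x * _"] cong: if_cong)

lemma tensor_one_mult_right_nth:
  "(X ** (A \<otimes>\<^sub>o mat 1)) $ p $ q = (\<Sum>j\<in>UNIV. X $ p $ (j, snd q) * A $ j $ fst q)"
  by (simp add: matrix_matrix_mult_def sum_prod_UNIV mat_nth if_distrib[of "\<lambda>x. _ * x"]
      if_distrib[of "\<lambda>x. x * _"] cong: if_cong)

lemma ptranspose_nth [simp]: "ptranspose_snd X $ p $ q = X $ (fst p, snd q) $ (fst q, snd p)"
  by (simp add: ptranspose_snd_def)

lemma ptranspose_sandwich:
  "ptranspose_snd ((A \<otimes>\<^sub>o mat 1) ** X ** (B \<otimes>\<^sub>o mat 1)) =
    (A \<otimes>\<^sub>o mat 1) ** ptranspose_snd X ** (B \<otimes>\<^sub>o mat 1)"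
  by (simp add: vec_eq_iff tensor_one_mult_right_nth tensor_one_mult_left_nth)

lemma mult_one_tensor_nth:
  "(X ** (mat 1 \<otimes>\<^sub>o A)) $ p $ q = (\<Sum>l\<in>UNIV. X $ p $ (fst q, l) * A $ l $ snd q)"
proof -
  have "(X ** (mat 1 \<otimes>\<^sub>o A)) $ p $ q =
      (\<Sum>j\<in>UNIV. if j = fst q then (\<Sum>l\<in>UNIV. X $ p $ (j, l) * A $ l $ snd q) else 0)"
    by (simp add: matrix_matrix_mult_def sum_prod_UNIV mat_nth del: sum.delta sum.delta')
       (intro sum.cong refl, auto)
  then show ?thesis by simp
qed

lemma trace_one_tensor: "trace (F ** (mat 1 \<otimes>\<^sub>o Y)) = trace (ptrace_fst F ** Y)"
proof -
  have "trace (F ** (mat 1 \<otimes>\<^sub>o Y)) = (\<Sum>i\<in>UNIV. \<Sum>k\<in>UNIV. \<Sum>l\<in>UNIV. F $ (i, k) $ (i, l) * Y $ l $ k)"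
    by (simp add: trace_def mult_one_tensor_nth sum_prod_UNIV)
  also have "\<dots> = (\<Sum>k\<in>UNIV. \<Sum>i\<in>UNIV. \<Sum>l\<in>UNIV. F $ (i, k) $ (i, l) * Y $ l $ k)"
    by (rule sum.swap)
  also have "\<dots> = (\<Sum>k\<in>UNIV. \<Sum>l\<in>UNIV. \<Sum>i\<in>UNIV. F $ (i, k) $ (i, l) * Y $ l $ k)"
    by (intro sum.cong refl sum.swap)
  also have "\<dots> = trace (ptrace_fst F ** Y)"
    by (simp add: trace_def matrix_matrix_mult_def ptrace_fst_def sum_distrib_right)
  finally show ?thesis .
qed

lemma trace_tensor: "trace (A \<otimes>\<^sub>o B) = trace A * trace B"
  by (simp add: trace_def sum_prod_UNIV sum_product)

section \<open>Linear maps, the Choi matrix and output states\<close>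

definition op_linear :: "('a::finite op \<Rightarrow> 'b::finite op) \<Rightarrow> bool"
  where "op_linear N \<longleftrightarrow> (\<forall>X Y. N (X + Y) = N X + N Y) \<and> (\<forall>c X. N (op_scale c X) = op_scale c (N X))"

definition trace_preserving :: "('a::finite op \<Rightarrow> 'b::finite op) \<Rightarrow> bool"
  where "trace_preserving N \<longleftrightarrow> (\<forall>X. trace (N X) = trace X)"

lemma op_linear_sum:
  assumes "op_linear N"
  shows "N (\<Sum>x\<in>I. f x) = (\<Sum>x\<in>I. N (f x))"
proof -
  have add: "N (X + Y) = N X + N Y" for X Y
    using assms by (simp add: op_linear_def)
  have "N 0 = 0" using add[of 0 0] by simp
  then show ?thesis
    by (induction I rule: infinite_finite_induct) (simp_all add: add)
qed

lemma op_expand: "X = (\<Sum>i\<in>UNIV. \<Sum>j\<in>UNIV. op_scale (X $ i $ j) (ketbra (ket i) (ket j)))"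
proof -
  have "(\<Sum>i\<in>UNIV. \<Sum>j\<in>UNIV. op_scale (X $ i $ j) (ketbra (ket i) (ket j))) $ k $ l = X $ k $ l" for k l
  proof -
    have "(\<Sum>i\<in>UNIV. \<Sum>j\<in>UNIV. op_scale (X $ i $ j) (ketbra (ket i) (ket j))) $ k $ l =
        (\<Sum>i\<in>UNIV. \<Sum>j\<in>UNIV. if j = l then if i = k then X $ i $ l else 0 else 0)"
      by (simp del: sum.delta sum.delta') (intro sum.cong refl, auto simp: ket_def axis_def)
    then show ?thesis by simp
  qed
  then show ?thesis by (simp add: vec_eq_iff)
qed

lemma op_linear_expand:
  assumes "op_linear N"
  shows "N X = (\<Sum>i\<in>UNIV. \<Sum>j\<in>UNIV. op_scale (X $ i $ j) (N (ketbra (ket i) (ket j))))"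
  by (subst op_expand[of X], simp only: op_linear_sum[OF assms])
     (use assms in \<open>simp add: op_linear_def\<close>)

lemma choi_nth: "choi N $ p $ q = N (ketbra (ket (fst p)) (ket (fst q))) $ snd p $ snd q"
proof -
  have "choi N $ p $ q = (\<Sum>i\<in>UNIV. \<Sum>j\<in>UNIV. if i = fst p \<and> j = fst q then N (ketbra (ket i) (ket j)) $ snd p $ snd q else 0)"
    by (simp add: choi_def) (intro sum.cong refl, auto simp: ket_def axis_def)
  also have "\<dots> = (\<Sum>i\<in>UNIV. if i = fst p then N (ketbra (ket i) (ket (fst q))) $ snd p $ snd q else 0)"
    by (intro sum.cong refl) auto
  finally show ?thesis by simp
qed

lemma max_ent_nth: "max_ent $ p $ q = (if fst p = snd p \<and> fst q = snd q then 1 else 0)"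
proof -
  have diag: "(\<Sum>i\<in>UNIV. ket (i, i) $ r) = (if fst r = snd r then 1 else 0)" for r :: "'a \<times> 'a"
  proof -
    have "(\<Sum>i\<in>UNIV. ket (i, i) $ r) =
        (\<Sum>i\<in>UNIV. if i = fst r then if fst r = snd r then 1 else 0 else (0::complex))"
      by (intro sum.cong refl) (auto simp: ket_def axis_def prod_eq_iff)
    then show ?thesis by simp
  qed
  have "max_ent $ p $ q = (\<Sum>i\<in>UNIV. ket (i, i) $ p) * cnj (\<Sum>j\<in>UNIV. ket (j, j) $ q)"
    by (simp add: max_ent_def sum_product)
  then show ?thesis by (simp add: diag)
qed

lemma purif_nth: "purif \<rho> $ p $ q = op_sqrt \<rho> $ snd p $ fst p * op_sqrt \<rho> $ fst q $ snd q"
proof -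
  let ?S = "op_sqrt \<rho>"
  have "((mat 1 \<otimes>\<^sub>o ?S) ** max_ent) $ p $ r = (if fst r = snd r then ?S $ snd p $ fst p else 0)" for r
    by (simp add: matrix_matrix_mult_def sum_prod_UNIV mat_nth max_ent_nth if_distrib[of "\<lambda>x. _ * x"]
        if_distrib[of "\<lambda>x. x * _"] cong: if_cong)
  then show ?thesis
    by (simp add: purif_def mult_one_tensor_nth if_distrib[of "\<lambda>x. x * _"] cong: if_cong)
qed

text \<open>The mirror identity (1 \<otimes> S)|\<Phi>> = (S^T \<otimes> 1)|\<Phi>> makes the
  reference system carry the transposed state.\<close>

lemma ptrace_snd_purif: "ptrace_snd (purif \<rho>) = transpose \<rho>" if "psd \<rho>"
proof -
  have "(\<Sum>k\<in>UNIV. op_sqrt \<rho> $ k $ i * op_sqrt \<rho> $ j $ k) = \<rho> $ j $ i" for i j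
    by (subst (3) op_sqrt_sq[OF that, symmetric]) (simp add: matrix_matrix_mult_def mult.commute)
  then show ?thesis by (simp add: vec_eq_iff ptrace_snd_def purif_nth transpose_def)
qed

text \<open>The mirror identity moves both square roots to the reference system, where they pass
  through id \<otimes> N; what remains between them is the image of \<open>max_ent\<close>, the Choi
  matrix.\<close>

lemma id_tensor_purif:
  assumes "op_linear N"
  shows "id_tensor N (purif \<rho>) =
    (transpose (op_sqrt \<rho>) \<otimes>\<^sub>o mat 1) ** choi N ** (transpose (op_sqrt \<rho>) \<otimes>\<^sub>o mat 1)"
    (is "?L = ?R")
proof -
  let ?S = "op_sqrt \<rho>"
  have "?L $ p $ q = ?R $ p $ q" for p q
  proof -
    have "?L $ p $ q = (\<Sum>m\<in>UNIV. \<Sum>n\<in>UNIV. ?S $ m $ fst p * ?S $ fst q $ n *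
        N (ketbra (ket m) (ket n)) $ snd p $ snd q)"
      by (simp add: id_tensor_def purif_nth) (subst op_linear_expand[OF assms], simp)
    also have "\<dots> = (\<Sum>n\<in>UNIV. \<Sum>m\<in>UNIV. ?S $ m $ fst p * ?S $ fst q $ n *
        N (ketbra (ket m) (ket n)) $ snd p $ snd q)"
      by (rule sum.swap)
    also have "\<dots> = ?R $ p $ q"
      by (simp add: tensor_one_mult_right_nth tensor_one_mult_left_nth choi_nth transpose_def
          sum_distrib_left sum_distrib_right ac_simps)
    finally show ?thesis .
  qed
  then show ?thesis by (simp add: vec_eq_iff)
qed

text \<open>Trace preservation says Tr_B J = 1. This gives the code \<omega> \<otimes> 1 success
  probability 1, and turns the error of a code F into Tr J G for its complement G = \<omega>
  \<otimes> 1 - F.\<close>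

lemma trace_choi_tensor_one:
  assumes "op_linear N" "trace_preserving N"
  shows "trace (choi N ** (X \<otimes>\<^sub>o mat 1)) = trace X"
proof -
  have tr: "trace (N (ketbra (ket i) (ket j))) = (if i = j then 1 else 0)" for i j
    using assms(2)
    by (simp add: trace_preserving_def trace_def ket_def axis_def if_distrib[of cnj] 
        if_distrib[of "\<lambda>x. _ * x"] if_distrib[of "\<lambda>x. x * _"] cong: if_cong)
  have "trace (choi N ** (X \<otimes>\<^sub>o mat 1)) =
     (\<Sum>i\<in>UNIV. \<Sum>k\<in>UNIV. \<Sum>j\<in>UNIV. N (ketbra (ket i) (ket j)) $ k $ k * X $ j $ i)"
    by (simp add: trace_def sum_prod_UNIV tensor_one_mult_right_nth choi_nth)
  also have "\<dots> = (\<Sum>i\<in>UNIV. \<Sum>j\<in>UNIV. \<Sum>k\<in>UNIV. N (ketbra (ket i) (ket j)) $ k $ k * X $ j $ i)"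
    by (intro sum.cong refl sum.swap)
  also have "\<dots> = (\<Sum>i\<in>UNIV. \<Sum>j\<in>UNIV. trace (N (ketbra (ket i) (ket j))) * X $ j $ i)"
    by (simp add: trace_def sum_distrib_right)
  also have "\<dots> = trace X"
    by (simp add: tr if_distrib[of "\<lambda>x. x * _"] cong: if_cong) (simp add: trace_def)
  finally show ?thesis .
qed

subsection \<open>Tests and coding operators\<close>

lemma matrix_mult_diff_left: "(A - B) ** C = A ** C - B ** C" for A B C :: "'n::finite op"
  by (simp add: vec_eq_iff matrix_matrix_mult_def algebra_simps sum_subtractf)

lemma matrix_mult_diff_right: "C ** (A - B) = C ** A - C ** B" for A B C :: "'n::finite op"
  by (simp add: vec_eq_iff matrix_matrix_mult_def algebra_simps sum_subtractf)

lemma dagger_one [simp]: "dagger (mat 1) = mat 1"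
  by (simp add: vec_eq_iff dagger_def mat_nth)

text \<open>A variant of Douglas' lemma: \<open>L\<close> plays the part of a pseudo-inverse of \<open>K\<close>.\<close>
lemma compress_below:
  fixes F K L :: "'n::finite op"
  assumes K: "dagger K = K" and L: "dagger L = L" and comm: "L ** K = K ** L" and KLK: "K ** (L ** K) = K"
    and one: "psd (mat 1 - L ** (K ** K) ** L)" and F: "psd F" "psd (K ** K - F)"
  shows "psd (L ** F ** L)" "psd (mat 1 - L ** F ** L)" "K ** (L ** F ** L) ** K = F"
proof -
  show "psd (L ** F ** L)" using psd_congruence[OF F(1), of L] L by simp
  have "psd (L ** (K ** K - F) ** L)" using psd_congruence[OF F(2), of L] L by simp
  then have "psd ((mat 1 - L ** (K ** K) ** L) + L ** (K ** K - F) ** L)" using one psd_add by blast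
  then show "psd (mat 1 - L ** F ** L)" by (simp add: matrix_mult_diff_left matrix_mult_diff_right)
  \<comment> \<open>\<open>Q\<close> maps into the kernel of \<open>K\<close>, and there 0 \<le> F
    \<le> K^2 forces F to vanish. So F = F L K, and compressing by \<open>L\<close> and expanding by
    \<open>K\<close> loses nothing.\<close>
  define Q where "Q = mat 1 - L ** K"
  have KQ: "K ** Q = 0" by (simp add: Q_def matrix_mult_diff_right KLK)
  have "F *v (Q *v v) = 0" for v
  proof (rule psd_null[OF F(1)])
    let ?w = "Q *v v"
    have "(K ** K) *v ?w = 0"
      by (simp add: matrix_vector_mul_assoc matrix_mul_assoc[symmetric] KQ)
    then have "0 \<le> - cip ?w (F *v ?w)"
      using F(2) by (simp add: psd_iff matrix_vector_mult_diff_rdistrib cip_diff_right)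
         (metis (no_types, lifting) cip_zero(2) diff_0)
    moreover have "0 \<le> cip ?w (F *v ?w)" using F(1) by (simp add: psd_iff)
    ultimately show "cip ?w (F *v ?w) = 0" by (simp add: less_eq_complex_def complex_eq_iff)
  qed
  then have "F ** Q = 0" by (simp add: matrix_eq matrix_vector_mul_assoc[symmetric])
  then have FLK: "F ** (L ** K) = F" by (simp add: Q_def matrix_mult_diff_right)
  then have "dagger (F ** (L ** K)) = dagger F" by simp
  then have "(K ** L) ** F = F" using psd_hermitian[OF F(1)] by (simp add: dagger_mult K L)
  then show "K ** (L ** F ** L) ** K = F" using FLK by (simp add: matrix_mul_assoc)
qed

text \<open>The constraints common to codes and tests. The marginal of \<open>F\<close> is left out,
  as it is where the two problems differ; \<open>ppt\<close> switches between the two versions of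
  each.\<close>

definition code_ops :: "bool \<Rightarrow> ('a::finite op \<Rightarrow> 'b::finite op) \<Rightarrow> real \<Rightarrow> 'a op \<Rightarrow> ('a \<times> 'b) op set"
  where "code_ops ppt N \<epsilon> \<omega> = {F. psd F \<and> psd (\<omega> \<otimes>\<^sub>o mat 1 - F) \<and> 1 - \<epsilon> \<le> Re (trace (choi N ** F)) \<and>
    (ppt \<longrightarrow> psd (ptranspose_snd F) \<and> psd (\<omega> \<otimes>\<^sub>o mat 1 - ptranspose_snd F))}"

text \<open>Conjugation by \<open>K\<close> maps tests to code operators, and
  \<open>compress_below\<close> reverses it even for singular \<omega>. Partial transposition on B
  commutes with conjugation by operators on A, so the same \<open>K\<close> and \<open>L\<close>
  carry the PPT constraint.\<close>

lemma test_values: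
  fixes N :: "'a::finite op \<Rightarrow> 'b::finite op"
  assumes \<rho>: "psd \<rho>" and N: "op_linear N"
  shows "{Re (trace (T ** (ptrace_snd (purif \<rho>) \<otimes>\<^sub>o \<sigma>))) | T.
      1 - Re (trace (T ** id_tensor N (purif \<rho>))) \<le> \<epsilon> \<and> 0 \<preceq> T \<and> T \<preceq> mat 1 \<and>
      (ppt \<longrightarrow> 0 \<preceq> ptranspose_snd T \<and> ptranspose_snd T \<preceq> mat 1)} =
    (\<lambda>F. Re (trace (F ** (mat 1 \<otimes>\<^sub>o \<sigma>)))) ` code_ops ppt N \<epsilon> (transpose \<rho>)"
    (is "?A = ?B")
proof -
  define \<omega> where "\<omega> = transpose \<rho>"
  define K :: "('a \<times> 'b) op" where "K = op_sqrt \<omega> \<otimes>\<^sub>o mat 1"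
  have \<omega>: "psd \<omega>" by (simp add: \<omega>_def psd_transpose \<rho>)
  have K: "dagger K = K" by (simp add: K_def dagger_tensor psd_hermitian op_sqrt_psd \<omega>)
  have KK: "K ** K = \<omega> \<otimes>\<^sub>o mat 1" by (simp add: K_def tensor_mult op_sqrt_sq \<omega>)
  have J: "id_tensor N (purif \<rho>) = K ** choi N ** K"
    by (simp add: id_tensor_purif[OF N] K_def \<omega>_def op_sqrt_transpose \<rho>)
  have \<sigma>: "ptrace_snd (purif \<rho>) \<otimes>\<^sub>o \<sigma> = K ** (mat 1 \<otimes>\<^sub>o \<sigma>) ** K"
    by (simp add: ptrace_snd_purif[OF \<rho>] K_def tensor_mult \<omega>_def[symmetric] op_sqrt_sq \<omega>)
  have tr: "trace (T ** (K ** Y ** K)) = trace ((K ** T ** K) ** Y)" for T Y :: "('a \<times> 'b) op"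
  proof -
    have "trace (T ** (K ** Y ** K)) = trace ((T ** K ** Y) ** K)" by (simp add: matrix_mul_assoc)
    also have "\<dots> = trace (K ** (T ** K ** Y))" by (rule trace_mul_sym)
    also have "\<dots> = trace ((K ** T ** K) ** Y)" by (simp add: matrix_mul_assoc)
    finally show ?thesis .
  qed
  have trJ: "trace (T ** id_tensor N (purif \<rho>)) = trace (choi N ** (K ** T ** K))" for T
    using tr[of T "choi N"] trace_mul_sym[of "K ** T ** K" "choi N"] by (simp only: J)
  have pt: "ptranspose_snd (K ** T ** K) = K ** ptranspose_snd T ** K" for T
    unfolding K_def by (rule ptranspose_sandwich)
  have up: "psd (K ** T ** K)" if "psd T" for T
    using psd_congruence[OF that, of K] K by simp
  have up': "psd (\<omega> \<otimes>\<^sub>o mat 1 - K ** T ** K)" if "psd (mat 1 - T)" for T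
    using up[OF that] by (simp add: matrix_mult_diff_left matrix_mult_diff_right KK)
  show ?thesis
  proof (rule set_eqI, rule iffI)
    fix x assume "x \<in> ?A"
    then obtain T where T: "x = Re (trace (T ** (ptrace_snd (purif \<rho>) \<otimes>\<^sub>o \<sigma>)))"
      "1 - Re (trace (T ** id_tensor N (purif \<rho>))) \<le> \<epsilon>" "psd T" "psd (mat 1 - T)"
      "ppt \<Longrightarrow> psd (ptranspose_snd T) \<and> psd (mat 1 - ptranspose_snd T)"
      by (auto simp: op_le_def)
    have "K ** T ** K \<in> code_ops ppt N \<epsilon> \<omega>"
      using T by (auto simp: code_ops_def up up' pt trJ)
    moreover have "x = Re (trace ((K ** T ** K) ** (mat 1 \<otimes>\<^sub>o \<sigma>)))"
      unfolding T(1) \<sigma> tr by (rule refl)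
    ultimately show "x \<in> ?B" unfolding \<omega>_def by blast
  next
    fix x assume "x \<in> ?B"
    then obtain F where F: "x = Re (trace (F ** (mat 1 \<otimes>\<^sub>o \<sigma>)))" "F \<in> code_ops ppt N \<epsilon> \<omega>"
      unfolding \<omega>_def by blast
    obtain R where R: "dagger R = R" "R ** op_sqrt \<omega> = op_sqrt \<omega> ** R"
      "op_sqrt \<omega> ** (R ** op_sqrt \<omega>) = op_sqrt \<omega>" "psd (mat 1 - R ** \<omega> ** R)"
      using op_sqrt_pseudo_inverse[OF \<omega>] by metis
    define L :: "('a \<times> 'b) op" where "L = R \<otimes>\<^sub>o mat 1"
    have L: "dagger L = L" "L ** K = K ** L" "K ** (L ** K) = K"
      using R by (simp_all add: L_def K_def dagger_tensor tensor_mult)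
    have "mat 1 - L ** (K ** K) ** L = (mat 1 - R ** \<omega> ** R) \<otimes>\<^sub>o mat 1"
      by (simp add: KK L_def tensor_mult tensor_diff_left tensor_one)
    then have L1: "psd (mat 1 - L ** (K ** K) ** L)" by (simp add: psd_tensor psd_one R)
    note down = compress_below[OF K L L1, unfolded KK]
    define T where "T = L ** F ** L"
    have ptT: "ptranspose_snd T = L ** ptranspose_snd F ** L"
      unfolding T_def L_def by (rule ptranspose_sandwich)
    have KTK: "K ** T ** K = F" unfolding T_def using F by (intro down) (auto simp: code_ops_def)
    have "psd T" "psd (mat 1 - T)"
      unfolding T_def using F by (auto simp: code_ops_def intro: down)
    moreover have "psd (ptranspose_snd T)" "psd (mat 1 - ptranspose_snd T)" if ppt
      unfolding ptT using F that by (auto simp: code_ops_def intro: down)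
    moreover have "1 - Re (trace (T ** id_tensor N (purif \<rho>))) \<le> \<epsilon>"
      using F by (simp add: trJ KTK code_ops_def)
    moreover have "x = Re (trace (T ** (ptrace_snd (purif \<rho>) \<otimes>\<^sub>o \<sigma>)))"
      unfolding \<sigma> tr KTK F(1) by (rule refl)
    ultimately show "x \<in> ?A" by (auto simp: op_le_def)
  qed
qed

section \<open>Compactness of the sets of states and codes\<close>

text \<open>Multiplying \<open>u\<close> by z = \<open>cip u v\<close> makes the inner product real
  and equal to |z|^2, which reduces the claim to the real Cauchy-Schwarz inequality.\<close>

lemma norm_cip_le: "cmod (cip u v) \<le> norm u * norm v"
proof (cases "cip u v = 0")
  case False
  define z where "z = cip u v"
  have "cip (z *s u) (z *s u) = of_real ((cmod z * norm u)\<^sup>2)"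
    unfolding cip_smult_left cip_smult_right
    by (simp add: cip_self power_mult_distrib del: of_real_power)
       (simp only: complex_norm_square simp_thms)
  then have "(norm (z *s u))\<^sup>2 = (cmod z * norm u)\<^sup>2"
    by (simp only: cip_self of_real_eq_iff)
  then have n: "norm (z *s u) = cmod z * norm u" by simp
  have "(cmod z)\<^sup>2 = Re (cip (z *s u) v)"
    by (simp add: cip_smult_left z_def[symmetric] mult.commute complex_norm_square[symmetric])
  also have "\<dots> \<le> cmod z * norm u * norm v"
    using norm_cauchy_schwarz[of "z *s u" v] by (simp add: Re_cip n)
  finally have "cmod z * cmod z \<le> cmod z * (norm u * norm v)" by (simp add: power2_eq_square mult.assoc)
  then show ?thesis using False by (simp add: z_def)
qed simp

text \<open>X is the Gram matrix of the columns of its square root, so this is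
  Cauchy-Schwarz.\<close>

lemma psd_minor: "(cmod (X $ i $ j))\<^sup>2 \<le> Re (X $ i $ i) * Re (X $ j $ j)" if X: "psd X"
proof -
  let ?S = "op_sqrt X"
  have e: "X $ k $ l = cip (?S *v ket k) (?S *v ket l)" for k l
  proof -
    have "X $ k $ l = cip (ket k) (?S *v (?S *v ket l))"
      by (simp add: cip_ket[symmetric] matrix_vector_mul_assoc op_sqrt_sq X)
    then show ?thesis by (simp add: cip_hermitian psd_hermitian op_sqrt_psd X)
  qed
  have "(cmod (X $ i $ j))\<^sup>2 \<le> (norm (?S *v ket i) * norm (?S *v ket j))\<^sup>2"
    unfolding e by (intro power_mono norm_cip_le) simp
  also have "\<dots> = Re (X $ i $ i) * Re (X $ j $ j)"
    by (simp add: e cip_self power_mult_distrib)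
  finally show ?thesis .
qed

lemma psd_entry_le_trace: "cmod (X $ i $ j) \<le> Re (trace X)" if X: "psd X"
proof -
  have nn: "0 \<le> Re (X $ k $ k)" for k using psd_diag[OF X, of k] by (simp add: less_eq_complex_def)
  have le: "Re (X $ k $ k) \<le> Re (trace X)" for k
    unfolding trace_def Re_sum by (rule member_le_sum) (auto simp: nn)
  have "(cmod (X $ i $ j))\<^sup>2 \<le> Re (trace X) * Re (trace X)"
    using psd_minor[OF X, of i j] mult_mono[OF le[of i] le[of j] order_trans[OF nn le[of i]] nn[of j]]
    by (rule order_trans)
  then show ?thesis
    using order_trans[OF nn le[of i]] power2_le_imp_le[of "cmod (X $ i $ j)" "Re (trace X)"]
    by (simp only: power2_eq_square)
qed

lemma bounded_psd_trace: "bounded {X :: 'n::finite op. psd X \<and> Re (trace X) \<le> c}"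
proof -
  have "norm X \<le> (\<Sum>i\<in>(UNIV::'n set). \<Sum>j\<in>(UNIV::'n set). c)" if "psd X" "Re (trace X) \<le> c" for X :: "'n op"
  proof -
    have "norm X \<le> (\<Sum>i\<in>UNIV. norm (X $ i))" unfolding norm_vec_def[of X] by (rule L2_set_le_sum) simp
    also have "\<dots> \<le> (\<Sum>i\<in>UNIV. \<Sum>j\<in>UNIV. norm (X $ i $ j))"
      by (rule sum_mono) (unfold norm_vec_def, rule L2_set_le_sum, simp)
    also have "\<dots> \<le> (\<Sum>i\<in>(UNIV::'n set). \<Sum>j\<in>(UNIV::'n set). c)"
      using psd_entry_le_trace[OF that(1)] that(2) by (intro sum_mono) (meson order_trans)
    finally show ?thesis .
  qed
  then show ?thesis unfolding bounded_iff by blast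
qed

lemma closed_psd: "closed {X :: 'n::finite op. psd X}"
proof -
  have "{X :: 'n op. psd X} = (\<Inter>v. {X. 0 \<le> Re (cip v (X *v v))} \<inter> {X. Im (cip v (X *v v)) = 0})"
    by (auto simp: psd_iff less_eq_complex_def)
  also have "closed \<dots>"
    unfolding cip_def matrix_vector_mult_def
    by (intro closed_INT ballI closed_Int closed_Collect_le closed_Collect_eq continuous_intros)
  finally show ?thesis .
qed

lemma closed_psd_comp: "closed {x. psd (f x)}" if "continuous_on UNIV f"
  using closed_vimage[OF closed_psd that] by (simp add: vimage_def)

lemma compact_density: "compact (density_ops :: 'n::finite op set)"
proof -
  have "closed ({X. psd X} \<inter> {X :: 'n op. trace X = 1})"
    unfolding trace_def by (intro closed_Int closed_psd closed_Collect_eq continuous_intros)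
  moreover have "density_ops = {X. psd X} \<inter> {X :: 'n op. trace X = 1}" by (auto simp: density_ops_def)
  moreover have "bounded (density_ops :: 'n op set)"
    by (rule bounded_subset[OF bounded_psd_trace[of 1]]) (auto simp: density_ops_def)
  ultimately show ?thesis by (simp add: compact_eq_bounded_closed)
qed

lemma density_nonempty: "(density_ops :: 'a::finite op set) \<noteq> {}"
proof -
  have "trace (ketbra (ket i) (ket i)) = 1" for i :: 'a
    by (simp add: trace_def ket_def axis_def if_distrib[of cnj] if_distrib[of "\<lambda>x. _ * x"] cong: if_cong)
  then have "ketbra (ket undefined) (ket undefined) \<in> (density_ops :: 'a op set)" by (simp add: density_ops_def psd_ketbra)
  then show ?thesis by blast
qed

lemma transpose_density: "transpose \<rho> \<in> density_ops \<longleftrightarrow> \<rho> \<in> density_ops"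
proof -
  have "trace (transpose \<rho>) = trace \<rho>" by (simp add: trace_def transpose_def)
  then show ?thesis unfolding density_ops_def using psd_transpose transpose_transpose by fastforce
qed

text \<open>Compactness of the joint set, and not only of each section, is what makes the optimal
  value semicontinuous in \<rho>. Boundedness comes from Tr F \<le> Tr(\<rho>^T \<otimes> 1) = dim
  B.\<close>

lemma compact_codes: "compact {(\<rho>, F). \<rho> \<in> density_ops \<and> F \<in> code_ops ppt N \<epsilon> (transpose \<rho>)}"
    (is "compact ?K")
proof -
  have cT: "continuous_on UNIV (\<lambda>x :: ('a op) \<times> ('a \<times> 'b) op. transpose (fst x) \<otimes>\<^sub>o mat 1 :: ('a \<times> 'b) op)"
    unfolding transpose_def tensor_op_def by (intro continuous_intros)
  have cP: "continuous_on UNIV (\<lambda>x :: ('a op) \<times> ('a \<times> 'b) op. ptranspose_snd (snd x))"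
    unfolding ptranspose_snd_def by (intro continuous_intros)
  define A :: "('a op \<times> ('a \<times> 'b) op) set" where "A = {x. psd (fst x)} \<inter> {x. trace (fst x) = 1} \<inter> {x. psd (snd x)} \<inter>
     {x. psd (transpose (fst x) \<otimes>\<^sub>o mat 1 - snd x)} \<inter> {x. 1 - \<epsilon> \<le> Re (trace (choi N ** snd x))}"
  define B :: "('a op \<times> ('a \<times> 'b) op) set" where
    "B = {x. psd (ptranspose_snd (snd x))} \<inter> {x. psd (transpose (fst x) \<otimes>\<^sub>o mat 1 - ptranspose_snd (snd x))}"
  have A: "closed A"
    unfolding A_def trace_def matrix_matrix_mult_def
    by (intro closed_Int closed_psd_comp closed_Collect_eq closed_Collect_le continuous_intros cT)
  have B: "closed B"
    unfolding B_def by (intro closed_Int closed_psd_comp continuous_intros cT cP)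
  have "?K = A \<inter> (if ppt then B else UNIV)"
    by (auto simp: A_def B_def code_ops_def density_ops_def)
  with A B have "closed ?K" by (simp add: closed_Int)
  moreover have "bounded ?K"
  proof (rule bounded_subset)
    show "bounded ((density_ops :: 'a op set) \<times> {F :: ('a \<times> 'b) op. psd F \<and> Re (trace F) \<le> of_nat CARD('b)})"
      by (intro bounded_Times bounded_psd_trace compact_imp_bounded compact_density)
    have "Re (trace F) \<le> of_nat CARD('b)" if "psd (transpose \<rho> \<otimes>\<^sub>o mat 1 - F)" "trace \<rho> = 1"
      for \<rho> :: "'a op" and F :: "('a \<times> 'b) op"
    proof -
      have "trace (transpose \<rho> \<otimes>\<^sub>o (mat 1 :: 'b op)) = of_nat CARD('b)"
        using that(2) by (simp add: trace_tensor) (simp add: trace_def transpose_def mat_nth)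
      then show ?thesis using psd_trace[OF that(1)] by (simp add: trace_sub less_eq_complex_def)
    qed
    then show "?K \<subseteq> density_ops \<times> {F. psd F \<and> Re (trace F) \<le> of_nat CARD('b)}"
      by (auto simp: code_ops_def density_ops_def)
  qed
  ultimately show ?thesis by (simp add: compact_eq_bounded_closed)
qed

subsection \<open>The max-min expression\<close>

text \<open>The sublevel sets at the values \<open>f y\<close> are closed, and finitely many of them
  share the point where the least of these values is taken. A point common to all of them is a
  minimiser.\<close>

lemma lsc_attains_min:
  fixes f :: "'s::t2_space \<Rightarrow> real"
  assumes S: "compact S" "S \<noteq> {}" and lsc: "\<And>c. closed {x \<in> S. f x \<le> c}"
  obtains x where "x \<in> S" "\<And>y. y \<in> S \<Longrightarrow> f x \<le> f y"
proof -
  have "S \<inter> (\<Inter>y\<in>S. {x \<in> S. f x \<le> f y}) \<noteq> {}"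
  proof (rule compact_imp_fip_image[OF S(1)])
    fix I' assume I': "finite I'" "I' \<subseteq> S"
    show "S \<inter> (\<Inter>y\<in>I'. {x \<in> S. f x \<le> f y}) \<noteq> {}"
    proof (cases "I' = {}")
      case False
      then obtain m where "m \<in> I'" "f m = Min (f ` I')"
        using I' Min_in[of "f ` I'"] by fastforce
      then have "m \<in> S \<inter> (\<Inter>y\<in>I'. {x \<in> S. f x \<le> f y})"
        using I' by auto
      then show ?thesis by blast
    qed (use S in auto)
  qed (rule lsc)
  with that show ?thesis by blast
qed

lemma neg_log2_antimono: "neg_log2 y \<le> neg_log2 x" if "x \<le> y"
  using that by (auto simp: neg_log2_def)

lemma neg_log2_strict: "neg_log2 y < neg_log2 x" if "x < y" "0 < y"
  using that by (auto simp: neg_log2_def)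

text \<open>\<open>neg_log2\<close> jumps to infinity at 0, so the infimum must be kept away from 0:
  a finite bound \<open>r\<close> puts every element above 2^(-r).\<close>

lemma neg_log2_Inf_le:
  assumes A: "A \<noteq> {}" "bdd_below A" and R: "\<And>x. x \<in> A \<Longrightarrow> neg_log2 x \<le> R"
  shows "neg_log2 (Inf A) \<le> R"
proof (cases R)
  case (real r)
  have "2 powr (- r) \<le> x" if "x \<in> A" for x
  proof -
    from R[OF that] real have "0 < x" "- log 2 x \<le> r" by (auto simp: neg_log2_def split: if_splits)
    then show ?thesis by (simp add: powr_le_iff)
  qed
  then have "2 powr (- r) \<le> Inf A" using A by (intro cInf_greatest)
  moreover from this have "0 < Inf A" by (auto intro: less_le_trans[of 0 "2 powr (- r)"])
  ultimately have "- r \<le> log 2 (Inf A)" by (simp add: le_log_iff)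
  then show ?thesis using \<open>0 < Inf A\<close> by (simp add: neg_log2_def real)
next
  case MInf
  obtain x where "x \<in> A" using A by blast
  from R[OF this] MInf show ?thesis by (simp add: neg_log2_def split: if_splits)
qed simp

text \<open>For fixed \<open>t\<close>, the value \<open>min\<^sub>x q x t\<close> over the \<open>s\<close>-section of the compact set \<open>K\<close> is lower
  semicontinuous in \<open>s\<close>, and so is its maximum over \<open>t\<close>; no minimax theorem is needed.\<close>
lemma is_maxmin_neg_log2:
  fixes S :: "'s::metric_space set" and T :: "'t::metric_space set" and K :: "('s \<times> 'x::metric_space) set"
  assumes S: "compact S" "S \<noteq> {}" and T: "compact T" "T \<noteq> {}"
    and K: "compact K" "\<And>s. s \<in> S \<Longrightarrow> \<exists>x. (s, x) \<in> K"
    and KS: "\<And>s x. (s, x) \<in> K \<Longrightarrow> s \<in> S"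
    and q1: "\<And>t. continuous_on UNIV (\<lambda>x. q x t)" and q2: "\<And>x. continuous_on UNIV (q x)"
  defines "f \<equiv> \<lambda>s t. neg_log2 (Inf ((\<lambda>x. q x t) ` {x. (s, x) \<in> K}))"
  shows "is_maxmin S T f (SUP s\<in>S. INF t\<in>T. f s t)"
proof -
  define \<phi> where "\<phi> s t = Inf ((\<lambda>x. q x t) ` {x. (s, x) \<in> K})" for s t
  have f: "f s t = neg_log2 (\<phi> s t)" for s t by (simp add: f_def \<phi>_def)
  have att: "\<exists>x. (s, x) \<in> K \<and> \<phi> s t = q x t \<and> (\<forall>x'. (s, x') \<in> K \<longrightarrow> q x t \<le> q x' t)" if "s \<in> S" for s t
  proof -
    let ?X = "snd ` (K \<inter> {s} \<times> UNIV)"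
    have X: "?X = {x. (s, x) \<in> K}" by force
    have "compact ?X"
      by (intro compact_continuous_image continuous_intros compact_Int_closed K closed_Times)
    moreover have "?X \<noteq> {}" using K(2)[OF that] by (simp add: X)
    ultimately obtain x where x: "x \<in> ?X" "\<forall>y\<in>?X. q x t \<le> q y t"
      using continuous_attains_inf[of ?X "\<lambda>x. q x t"] continuous_on_subset[OF q1 subset_UNIV] by metis
    have "\<phi> s t = q x t"
      unfolding \<phi>_def X[symmetric] using x by (intro cInf_eq_minimum) auto
    then show ?thesis using x X by blast
  qed
  have ge: "c \<le> \<phi> s t \<longleftrightarrow> (\<forall>x. (s, x) \<in> K \<longrightarrow> c \<le> q x t)" if "s \<in> S" for s t c
    using att[OF that, of t] by force
  have "\<exists>t. t \<in> T \<and> (\<forall>t'\<in>T. \<phi> s t' \<le> \<phi> s t)" if s: "s \<in> S" for s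
  proof -
    \<comment> \<open>As an infimum of functions continuous in \<open>t\<close>,
      \<open>\<phi> s\<close> is upper semicontinuous, so it attains its maximum on
      \<open>T\<close>.\<close>
    have "closed {t \<in> T. - \<phi> s t \<le> c}" for c
    proof -
      have "{t \<in> T. - \<phi> s t \<le> c} = T \<inter> (\<Inter>x\<in>{x. (s, x) \<in> K}. {t. - c \<le> q x t})"
        using ge[OF s, of "- c"] by (auto simp: minus_le_iff)
      also have "closed \<dots>"
        by (intro closed_Int closed_INT ballI compact_imp_closed T closed_Collect_le continuous_intros q2)
      finally show ?thesis .
    qed
    then obtain t where "t \<in> T" "\<And>t'. t' \<in> T \<Longrightarrow> - \<phi> s t \<le> - \<phi> s t'"
      using lsc_attains_min[OF T, of "\<lambda>t. - \<phi> s t"] by blast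
    then show ?thesis by auto
  qed
  \<comment> \<open>Since \<open>neg_log2\<close> reverses the order, the maximiser of
    \<open>\<phi> s\<close> yields the inner minimum of the divergence.\<close>
  then obtain \<tau> where \<tau>: "\<And>s. s \<in> S \<Longrightarrow> \<tau> s \<in> T" "\<And>s t. s \<in> S \<Longrightarrow> t \<in> T \<Longrightarrow> \<phi> s t \<le> \<phi> s (\<tau> s)"
    by metis
  define h where "h s = \<phi> s (\<tau> s)" for s
  have "closed {s \<in> S. h s \<le> c}" for c
  proof -
    \<comment> \<open>Minima over \<open>x\<close> are attained, so the condition
      \<open>\<phi> s t \<le> c\<close> describes a projection of a compact set; intersecting over
      \<open>t\<close> gives the sublevel set of \<open>h\<close>.\<close>
    have "{s \<in> S. h s \<le> c} = (\<Inter>t\<in>T. fst ` (K \<inter> UNIV \<times> {x. q x t \<le> c}))"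
    proof (rule set_eqI, rule iffI)
      fix s assume s: "s \<in> {s \<in> S. h s \<le> c}"
      have "s \<in> fst ` (K \<inter> UNIV \<times> {x. q x t \<le> c})" if "t \<in> T" for t
      proof -
        obtain x where "(s, x) \<in> K" "\<phi> s t = q x t" using att[of s t] s by blast
        moreover have "\<phi> s t \<le> c" using s that \<tau>(2)[of s t] by (simp add: h_def)
        ultimately show ?thesis by force
      qed
      then show "s \<in> (\<Inter>t\<in>T. fst ` (K \<inter> UNIV \<times> {x. q x t \<le> c}))" by blast
    next
      fix s assume s: "s \<in> (\<Inter>t\<in>T. fst ` (K \<inter> UNIV \<times> {x. q x t \<le> c}))"
      then have sS: "s \<in> S" using T(2) KS by fastforce
      then obtain x where "(s, x) \<in> K" "q x (\<tau> s) \<le> c" using s \<tau>(1)[of s] by force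
      then have "h s \<le> c" using att[OF sS, of "\<tau> s"] by (auto simp: h_def)
      with sS show "s \<in> {s \<in> S. h s \<le> c}" by simp
    qed
    also have "closed \<dots>"
      by (intro closed_INT ballI compact_imp_closed compact_continuous_image compact_Int_closed K(1)
          closed_Times closed_UNIV closed_Collect_le q1 continuous_intros)
    finally show ?thesis .
  qed
  then obtain s where s: "s \<in> S" "\<And>s'. s' \<in> S \<Longrightarrow> h s \<le> h s'"
    using lsc_attains_min[OF S, of h] by blast
  define g where "g s = neg_log2 (h s)" for s
  have inf: "(INF t\<in>T. f s t) = g s" if "s \<in> S" for s
  proof (rule antisym)
    show "(INF t\<in>T. f s t) \<le> g s"
      using \<tau>(1)[OF that] by (auto simp: g_def h_def f intro: INF_lower)
    show "g s \<le> (INF t\<in>T. f s t)"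
      using \<tau>(2)[OF that] by (auto simp: g_def h_def f intro!: INF_greatest neg_log2_antimono)
  qed
  have gs: "g s' \<le> g s" if "s' \<in> S" for s' using s(2)[OF that] by (simp add: g_def neg_log2_antimono)
  have "(SUP s\<in>S. INF t\<in>T. f s t) = (SUP s\<in>S. g s)" by (rule SUP_cong) (auto simp: inf)
  also have "\<dots> = g s" using s(1) gs by (intro antisym SUP_least SUP_upper) auto
  finally have sup: "(SUP s\<in>S. INF t\<in>T. f s t) = g s" .
  show ?thesis
    unfolding is_maxmin_def sup
  proof (intro exI[of _ g] conjI ballI)
    show "g s' \<in> f s' ` T" if "s' \<in> S" for s' using \<tau>(1)[OF that] by (auto simp: g_def h_def f)
    show "g s' \<le> f s' t" if "s' \<in> S" "t \<in> T" for s' t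
      using \<tau>(2)[OF that] by (auto simp: g_def h_def f neg_log2_antimono)
  qed (use s gs in auto)
qed

section \<open>Capacities and max-min values through code operators\<close>

text \<open>By \<open>test_values\<close> this is \<open>D_H\<close> or \<open>D_H_PPT\<close>
  between the output state and the product state, with tests replaced by code operators.\<close>

definition test_div :: "bool \<Rightarrow> ('a::finite op \<Rightarrow> 'b::finite op) \<Rightarrow> real \<Rightarrow> 'a op \<Rightarrow> 'b op \<Rightarrow> ereal"
  where "test_div ppt N \<epsilon> \<rho> \<sigma> =
    neg_log2 (Inf ((\<lambda>F. Re (trace (F ** (mat 1 \<otimes>\<^sub>o \<sigma>)))) ` code_ops ppt N \<epsilon> (transpose \<rho>)))"

definition R_div :: "bool \<Rightarrow> ('a::finite op \<Rightarrow> 'b::finite op) \<Rightarrow> real \<Rightarrow> ereal"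
  where "R_div ppt N \<epsilon> = (SUP \<rho>\<in>density_ops. INF \<sigma>\<in>density_ops. test_div ppt N \<epsilon> \<rho> \<sigma>)"

definition code_rates :: "bool \<Rightarrow> ('a::finite op \<Rightarrow> 'b::finite op) \<Rightarrow> real \<Rightarrow> real set"
  where "code_rates ppt N \<epsilon> = {\<eta>. \<exists>F \<rho>. trace \<rho> = 1 \<and> F \<in> code_ops ppt N \<epsilon> \<rho> \<and>
    ptrace_fst F = mat (complex_of_real \<eta>)}"

lemma C_NS_eq: "C_NS N \<epsilon> = neg_log2 (Inf (code_rates False N \<epsilon>))"
  unfolding C_NS_def code_rates_def ns_feasible_def code_ops_def op_le_def
  by (rule arg_cong[where f = "\<lambda>A. neg_log2 (Inf A)"]) auto

lemma C_NS_PPT_eq: "C_NS_PPT N \<epsilon> = neg_log2 (Inf (code_rates True N \<epsilon>))"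
  unfolding C_NS_PPT_def code_rates_def ns_feasible_def code_ops_def op_le_def
  by (rule arg_cong[where f = "\<lambda>A. neg_log2 (Inf A)"]) auto

lemma D_H_eq:
  assumes "psd \<rho>" "op_linear N"
  shows "D_H \<epsilon> (id_tensor N (purif \<rho>)) (ptrace_snd (purif \<rho>) \<otimes>\<^sub>o \<sigma>) = test_div False N \<epsilon> \<rho> \<sigma>"
  unfolding D_H_def test_div_def test_values[OF assms, symmetric] by simp

lemma D_H_PPT_eq:
  assumes "psd \<rho>" "op_linear N"
  shows "D_H_PPT \<epsilon> (id_tensor N (purif \<rho>)) (ptrace_snd (purif \<rho>) \<otimes>\<^sub>o \<sigma>) = test_div True N \<epsilon> \<rho> \<sigma>"
  unfolding D_H_PPT_def test_div_def test_values[OF assms, symmetric] by simp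

lemma R_E_eq: "R_E N \<epsilon> = R_div False N \<epsilon>" if "op_linear N"
  unfolding R_E_def R_div_def
  by (rule SUP_cong) (auto simp: density_ops_def D_H_eq that)

lemma R_E_PPT_eq: "R_E_PPT N \<epsilon> = R_div True N \<epsilon>" if "op_linear N"
  unfolding R_E_PPT_def R_div_def
  by (rule SUP_cong) (auto simp: density_ops_def D_H_PPT_eq that)

lemma is_maxmin_cong:
  "is_maxmin S T f m \<longleftrightarrow> is_maxmin S T f' m" if "\<And>s t. s \<in> S \<Longrightarrow> t \<in> T \<Longrightarrow> f s t = f' s t"
proof -
  have "f s ` T = f' s ` T" if "s \<in> S" for s using that \<open>\<And>s t. _ \<Longrightarrow> _ \<Longrightarrow> f s t = f' s t\<close> by auto
  then show ?thesis using that by (simp add: is_maxmin_def)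
qed

lemma ptranspose_tensor_one: "ptranspose_snd (\<omega> \<otimes>\<^sub>o mat 1) = \<omega> \<otimes>\<^sub>o mat 1"
  by (simp add: vec_eq_iff mat_nth)

text \<open>The trivial code, with \<eta> = 1 and no error; it makes the feasible sets
  nonempty.\<close>

lemma tensor_one_code:
  assumes "op_linear N" "trace_preserving N" "0 \<le> \<epsilon>" "psd \<omega>" "trace \<omega> = 1"
  shows "\<omega> \<otimes>\<^sub>o mat 1 \<in> code_ops ppt N \<epsilon> \<omega>"
  using assms by (simp add: code_ops_def psd_tensor psd_one trace_choi_tensor_one ptranspose_tensor_one)

lemma ptrace_fst_tensor: "ptrace_fst (\<omega> \<otimes>\<^sub>o Y) = op_scale (trace \<omega>) Y"
  by (simp add: vec_eq_iff ptrace_fst_def trace_def sum_distrib_right)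

lemma op_scale_one [simp]: "op_scale 1 X = X"
  by (simp add: vec_eq_iff)

lemma one_in_code_rates:
  fixes N :: "'a::finite op \<Rightarrow> 'b::finite op"
  assumes "op_linear N" "trace_preserving N" "0 \<le> \<epsilon>"
  shows "1 \<in> code_rates ppt N \<epsilon>"
proof -
  obtain \<omega> :: "'a op" where "psd \<omega>" "trace \<omega> = 1"
    using density_nonempty by (auto simp: density_ops_def)
  then show ?thesis
    using tensor_one_code[OF assms, of \<omega> ppt]
    unfolding code_rates_def by (auto simp: ptrace_fst_tensor intro!: exI[of _ "\<omega> \<otimes>\<^sub>o mat 1"] exI[of _ \<omega>])
qed

lemma code_rates_nonneg:
  fixes N :: "'a::finite op \<Rightarrow> 'b::finite op"
  assumes \<eta>: "\<eta> \<in> code_rates ppt N \<epsilon>"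
  shows "0 \<le> \<eta>"
proof -
  obtain F :: "('a \<times> 'b) op" where "psd F" "ptrace_fst F = mat (complex_of_real \<eta>)"
    using \<eta> unfolding code_rates_def code_ops_def by blast
  have "0 \<le> ptrace_fst F $ undefined $ undefined"
    using \<open>psd F\<close> by (simp add: ptrace_fst_def sum_nonneg psd_diag)
  then show ?thesis using \<open>ptrace_fst F = _\<close> by (simp add: mat_nth less_eq_complex_def)
qed

lemma R_div_lower:
  assumes \<rho>: "\<rho> \<in> density_ops" and F: "F \<in> code_ops ppt N \<epsilon> \<rho>"
    and le: "psd (mat (complex_of_real \<eta>) - ptrace_fst F)"
  shows "neg_log2 \<eta> \<le> R_div ppt N \<epsilon>"
proof -
  \<comment> \<open>\<open>test_div\<close> transposes its input state, so the outer supremum is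
    probed at \<open>transpose \<rho>\<close>.\<close>
  have "neg_log2 \<eta> \<le> test_div ppt N \<epsilon> (transpose \<rho>) \<sigma>" if \<sigma>: "\<sigma> \<in> density_ops" for \<sigma>
    unfolding test_div_def transpose_transpose
  proof (rule neg_log2_antimono)
    have \<sigma>': "psd \<sigma>" "trace \<sigma> = 1" using \<sigma> by (auto simp: density_ops_def)
    have nn: "0 \<le> Re (trace (F' ** (mat 1 \<otimes>\<^sub>o \<sigma>)))" if "psd F'" for F' :: "('a \<times> 'b) op"
      using trace_psd_mult[OF that psd_tensor[OF psd_one \<sigma>'(1)]] by (simp add: less_eq_complex_def)
    have "bdd_below ((\<lambda>F. Re (trace (F ** (mat 1 \<otimes>\<^sub>o \<sigma>)))) ` code_ops ppt N \<epsilon> \<rho>)"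
      by (rule bdd_belowI2[of _ 0]) (auto simp: code_ops_def intro: nn)
    then have "Inf ((\<lambda>F. Re (trace (F ** (mat 1 \<otimes>\<^sub>o \<sigma>)))) ` code_ops ppt N \<epsilon> \<rho>) \<le>
        Re (trace (F ** (mat 1 \<otimes>\<^sub>o \<sigma>)))"
      using F by (intro cInf_lower) auto
    also have "\<dots> \<le> \<eta>"
    proof -
      have "mat (complex_of_real \<eta>) ** \<sigma> = op_scale \<eta> \<sigma>"
        by (simp add: vec_eq_iff matrix_matrix_mult_def mat_nth if_distrib[of "\<lambda>x. x * _"] cong: if_cong)
      then have "trace (mat (complex_of_real \<eta>) ** \<sigma>) = \<eta>"
        using \<sigma>'(2) by (simp add: trace_def sum_distrib_left[symmetric])
      then show ?thesis
        using trace_psd_mult[OF le \<sigma>'(1)]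
        by (simp add: trace_one_tensor matrix_mult_diff_left trace_sub less_eq_complex_def)
    qed
    finally show "Inf ((\<lambda>F. Re (trace (F ** (mat 1 \<otimes>\<^sub>o \<sigma>)))) ` code_ops ppt N \<epsilon> \<rho>) \<le> \<eta>" .
  qed
  then have "neg_log2 \<eta> \<le> (INF \<sigma>\<in>density_ops. test_div ppt N \<epsilon> (transpose \<rho>) \<sigma>)" by (rule INF_greatest)
  also have "\<dots> \<le> R_div ppt N \<epsilon>"
    unfolding R_div_def using \<rho> by (intro SUP_upper) (simp add: transpose_density)
  finally show ?thesis .
qed

text \<open>Test the form on product vectors v \<otimes> e_k with a fixed basis vector e_k. The
  capacity program imposes only Tr \<rho> = 1; positivity of \<rho> is recovered from 0 \<le> F
  \<le> \<rho> \<otimes> 1.\<close>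

lemma psd_tensor_oneD: "psd \<omega>" if "psd (\<omega> \<otimes>\<^sub>o (mat 1 :: 'b::finite op))" for \<omega> :: "'a::finite op"
proof -
  define e :: "complex ^ 'a \<Rightarrow> complex ^ ('a \<times> 'b)" where
    "e v = (\<chi> p. if snd p = undefined then v $ fst p else 0)" for v
  have "((\<omega> \<otimes>\<^sub>o (mat 1 :: 'b op)) *v e v) $ p = e (\<omega> *v v) $ p" for v p
  proof -
    have "((\<omega> \<otimes>\<^sub>o (mat 1 :: 'b op)) *v e v) $ p = (\<Sum>j\<in>UNIV. \<Sum>k\<in>(UNIV :: 'b set).
        if k = undefined then if snd p = undefined then \<omega> $ fst p $ j * v $ j else 0 else 0)"
      unfolding matrix_vector_mult_def vec_lambda_beta sum_prod_UNIV
      by (intro sum.cong refl) (auto simp: e_def mat_nth)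
    then show ?thesis by (simp add: e_def matrix_vector_mult_def)
  qed
  then have mv: "(\<omega> \<otimes>\<^sub>o (mat 1 :: 'b op)) *v e v = e (\<omega> *v v)" for v
    by (simp add: vec_eq_iff)
  have "cip (e u) (e v) = cip u v" for u v
  proof -
    have "cip (e u) (e v) = (\<Sum>j\<in>UNIV. \<Sum>k\<in>(UNIV :: 'b set). if k = undefined then cnj (u $ j) * v $ j else 0)"
      unfolding cip_def sum_prod_UNIV by (intro sum.cong refl) (simp add: e_def)
    then show ?thesis by (simp add: cip_def)
  qed
  then have "cip v (\<omega> *v v) = cip (e v) ((\<omega> \<otimes>\<^sub>o (mat 1 :: 'b op)) *v e v)" for v
    by (simp only: mv)
  then show ?thesis using that by (simp add: psd_iff)
qed

lemma code_rate_le_R_div: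
  fixes N :: "'a::finite op \<Rightarrow> 'b::finite op"
  assumes "\<eta> \<in> code_rates ppt N \<epsilon>"
  shows "neg_log2 \<eta> \<le> R_div ppt N \<epsilon>"
proof -
  obtain F :: "('a \<times> 'b) op" and \<rho> where F: "trace \<rho> = 1" "F \<in> code_ops ppt N \<epsilon> \<rho>" "ptrace_fst F = mat (complex_of_real \<eta>)"
    using assms by (auto simp: code_rates_def)
  then have "psd (F + (\<rho> \<otimes>\<^sub>o mat 1 - F))" by (intro psd_add) (auto simp: code_ops_def)
  then have "psd (\<rho> \<otimes>\<^sub>o (mat 1 :: 'b op))" by simp
  then have "psd \<rho>" by (rule psd_tensor_oneD)
  with F show ?thesis by (intro R_div_lower[of \<rho> F]) (auto simp: density_ops_def)
qed

lemma capacity_le_R_div: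
  assumes "op_linear N" "trace_preserving N" "0 \<le> \<epsilon>"
  shows "neg_log2 (Inf (code_rates ppt N \<epsilon>)) \<le> R_div ppt N \<epsilon>"
  using one_in_code_rates[OF assms] code_rates_nonneg code_rate_le_R_div
  by (intro neg_log2_Inf_le bdd_belowI[of _ 0]) blast+

text \<open>A gap certificate: a bound \<open>c\<close> below the parameters of all codes, and one
  operator meeting the marginal inequality at \<eta> < c. A uniform \<open>c\<close> is needed to
  keep the infimum over codes away from \<eta>.\<close>

lemma capacity_less_R_div:
  assumes "op_linear N" "trace_preserving N" "0 \<le> \<epsilon>"
    and "\<rho> \<in> density_ops" "F \<in> code_ops ppt N \<epsilon> \<rho>" "psd (mat (complex_of_real \<eta>) - ptrace_fst F)"
    and c: "\<And>\<eta>'. \<eta>' \<in> code_rates ppt N \<epsilon> \<Longrightarrow> c \<le> \<eta>'" "\<eta> < c" "0 < c"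
  shows "neg_log2 (Inf (code_rates ppt N \<epsilon>)) < R_div ppt N \<epsilon>"
proof -
  have "c \<le> Inf (code_rates ppt N \<epsilon>)"
    using one_in_code_rates[OF assms(1-3)] c(1) by (intro cInf_greatest) auto
  then have "neg_log2 (Inf (code_rates ppt N \<epsilon>)) \<le> neg_log2 c" by (rule neg_log2_antimono)
  also have "\<dots> < neg_log2 \<eta>" using c by (intro neg_log2_strict)
  also have "\<dots> \<le> R_div ppt N \<epsilon>" using assms(4-6) by (rule R_div_lower)
  finally show ?thesis .
qed

lemma is_maxmin_test_div:
  fixes N :: "'a::finite op \<Rightarrow> 'b::finite op"
  assumes N: "op_linear N" "trace_preserving N" "0 \<le> \<epsilon>"
  shows "is_maxmin density_ops density_ops (test_div ppt N \<epsilon>) (R_div ppt N \<epsilon>)"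
proof -
  let ?K = "{(\<rho>, F). \<rho> \<in> density_ops \<and> F \<in> code_ops ppt N \<epsilon> (transpose \<rho>)}"
  let ?f = "\<lambda>\<rho> \<sigma>. neg_log2 (Inf ((\<lambda>F. Re (trace (F ** (mat 1 \<otimes>\<^sub>o \<sigma>)))) ` {F. (\<rho>, F) \<in> ?K}))"
  have f: "?f \<rho> \<sigma> = test_div ppt N \<epsilon> \<rho> \<sigma>" if "\<rho> \<in> density_ops" for \<rho> \<sigma>
    using that by (simp add: test_div_def)
  have "is_maxmin density_ops density_ops ?f (SUP \<rho>\<in>density_ops. INF \<sigma>\<in>density_ops. ?f \<rho> \<sigma>)"
  proof (rule is_maxmin_neg_log2)
    show "\<exists>F. (\<rho>, F) \<in> ?K" if "\<rho> \<in> density_ops" for \<rho> :: "'a op"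
    proof -
      have "psd (transpose \<rho>)" "trace (transpose \<rho>) = 1"
        using that transpose_density[of \<rho>] by (auto simp: density_ops_def)
      then show ?thesis using that tensor_one_code[OF N] by blast
    qed
    show "continuous_on UNIV (\<lambda>F. Re (trace (F ** (mat 1 \<otimes>\<^sub>o \<sigma>))))" for \<sigma> :: "'b op"
      unfolding trace_def matrix_matrix_mult_def by (intro continuous_intros)
    show "continuous_on UNIV (\<lambda>\<sigma>. Re (trace (F ** (mat 1 \<otimes>\<^sub>o \<sigma>))))" for F :: "('a \<times> 'b) op"
      unfolding trace_def matrix_matrix_mult_def tensor_op_def by (intro continuous_intros)
  qed (auto simp: compact_density density_nonempty compact_codes)
  moreover have "(SUP \<rho>\<in>density_ops. INF \<sigma>\<in>density_ops. ?f \<rho> \<sigma>) = R_div ppt N \<epsilon>"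
    unfolding R_div_def by (intro SUP_cong INF_cong refl f)
  ultimately show ?thesis
    using is_maxmin_cong[of density_ops density_ops ?f "test_div ppt N \<epsilon>"] f by simp
qed

subsection \<open>Strictness for qubit channels\<close>

lemma forall_qubit: "(\<forall>i :: 2. P i) \<longleftrightarrow> P 0 \<and> P 1"
proof -
  \<comment> \<open>Arithmetic in the type \<open>2\<close> is modulo two, so the numeral 2 is the
    basis label 0.\<close>
  have "(2 :: 2) = 0" by simp
  then show ?thesis using forall_2[of P] by metis
qed

lemma qubit_cases: "i = 0 \<or> i = (1 :: 2)"
  using forall_qubit[of "\<lambda>i. i = 0 \<or> i = 1"] by simp

lemma sum_qubit:
  fixes f :: "2 \<Rightarrow> 'a::comm_monoid_add"
  shows "(\<Sum>i\<in>UNIV. f i) = f 0 + f 1"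
proof -
  have U: "(UNIV :: 2 set) = {0, 1}" using qubit_cases by auto
  have "(\<Sum>i\<in>UNIV. f i) = (\<Sum>i\<in>{0, 1}. f i)" unfolding U by (rule refl)
  then show ?thesis by simp
qed

lemma qubit_neq [simp]: "x \<noteq> (0::2) \<longleftrightarrow> x = 1" "x \<noteq> (1::2) \<longleftrightarrow> x = 0"
  using qubit_cases[of x] by auto

definition diag2 :: "real \<Rightarrow> real \<Rightarrow> 2 op"
  where "diag2 a b = (\<chi> i j. if i = j then of_real (if i = 0 then a else b) else 0)"

lemma psd_diag2: "psd (diag2 a b)" if "0 \<le> a" "0 \<le> b"
proof -
  have "diag2 a b = op_scale (of_real a) (ketbra (ket 0) (ket 0)) + op_scale (of_real b) (ketbra (ket 1) (ket 1))"
    by (simp add: diag2_def vec_eq_iff forall_qubit ket_def axis_def)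
  then show ?thesis using that by (simp add: psd_add psd_scale psd_ketbra)
qed

lemma diag2_half_density: "diag2 (1 / 2) (1 / 2) \<in> density_ops"
  by (simp add: density_ops_def psd_diag2) (simp add: trace_def sum_qubit diag2_def)

text \<open>The X-shaped matrix with diagonal \<open>a, b, c, d\<close>, and off-diagonal entries \<open>x\<close> between
  \<open>|00\<rangle>\<close> and \<open>|11\<rangle>\<close> and \<open>y\<close> between \<open>|01\<rangle>\<close> and \<open>|10\<rangle>\<close>.\<close>
definition X_op :: "real \<Rightarrow> real \<Rightarrow> real \<Rightarrow> real \<Rightarrow> real \<Rightarrow> real \<Rightarrow> (2 \<times> 2) op"
  where "X_op a b c d x y = (\<chi> p q. of_real (
    if fst p = fst q \<and> snd p = snd q then
      if fst p = 0 then if snd p = 0 then a else b else if snd p = 0 then c else d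
    else if fst p \<noteq> fst q \<and> snd p \<noteq> snd q then if fst p = snd p then x else y
    else 0))"

lemma quadratic_form_nonneg:
  fixes a d x p r :: real
  assumes "0 \<le> a" "0 \<le> d" "x\<^sup>2 \<le> a * d"
  shows "0 \<le> a * p\<^sup>2 + d * r\<^sup>2 + 2 * x * p * r"
proof (cases "a = 0")
  case True
  then have "x = 0" using assms by simp
  then show ?thesis using True assms by simp
next
  case False
  have "a * (a * p\<^sup>2 + d * r\<^sup>2 + 2 * x * p * r) = (a * p + x * r)\<^sup>2 + (a * d - x\<^sup>2) * r\<^sup>2"
    by (simp add: power2_eq_square algebra_simps)
  also have "0 \<le> \<dots>" using assms by simp
  finally show ?thesis using False assms(1) by (simp add: zero_le_mult_iff)
qed

text \<open>With real entries, the form splits over real and imaginary parts and over the planes of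
  |00>, |11> and of |01>, |10> into four real binary forms.\<close>

lemma psd_X_op:
  assumes "0 \<le> a" "0 \<le> b" "0 \<le> c" "0 \<le> d" "x\<^sup>2 \<le> a * d" "y\<^sup>2 \<le> b * c"
  shows "psd (X_op a b c d x y)"
proof -
  have "0 \<le> cip v (X_op a b c d x y *v v)" for v
  proof -
    obtain p q where 0: "v $ (0, 0) = Complex p q" by (meson complex.exhaust)
    obtain r s where 1: "v $ (1, 1) = Complex r s" by (meson complex.exhaust)
    obtain t u where 2: "v $ (0, 1) = Complex t u" by (meson complex.exhaust)
    obtain m n where 3: "v $ (1, 0) = Complex m n" by (meson complex.exhaust)
    have "cip v (X_op a b c d x y *v v) =
        of_real ((a * p\<^sup>2 + d * r\<^sup>2 + 2 * x * p * r) + (a * q\<^sup>2 + d * s\<^sup>2 + 2 * x * q * s) +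
          (b * t\<^sup>2 + c * m\<^sup>2 + 2 * y * t * m) + (b * u\<^sup>2 + c * n\<^sup>2 + 2 * y * u * n))"
      by (simp add: cip_def matrix_vector_mult_def sum_prod_UNIV sum_qubit X_op_def 0 1 2 3 complex_eq_iff
          power2_eq_square algebra_simps)
    moreover have "0 \<le> (a * p\<^sup>2 + d * r\<^sup>2 + 2 * x * p * r) + (a * q\<^sup>2 + d * s\<^sup>2 + 2 * x * q * s) +
          (b * t\<^sup>2 + c * m\<^sup>2 + 2 * y * t * m) + (b * u\<^sup>2 + c * n\<^sup>2 + 2 * y * u * n)"
      using assms by (intro add_nonneg_nonneg[of "_ + _ + 2 * _ * _ * _"] add_nonneg_nonneg[of "_ + _ + _"]
        quadratic_form_nonneg)
    ultimately show ?thesis by (simp add: less_eq_complex_def)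
  qed
  then show ?thesis by (simp add: psd_iff)
qed

lemma X_op_diff: "X_op a b c d x y - X_op a' b' c' d' x' y' = X_op (a - a') (b - b') (c - c') (d - d') (x - x') (y - y')"
  by (simp add: X_op_def vec_eq_iff split_paired_All forall_qubit)

text \<open>When both the matrix and its partial transpose are positive, each coherence is therefore
  bounded by both diagonal products, a d and b c.\<close>

lemma ptranspose_X_op: "ptranspose_snd (X_op a b c d x y) = X_op a b c d y x"
  by (simp add: X_op_def vec_eq_iff forall_qubit split_paired_All)

lemma diag2_tensor_one: "diag2 p q \<otimes>\<^sub>o mat 1 = X_op p p q q 0 0"
  by (simp add: X_op_def diag2_def mat_nth vec_eq_iff forall_qubit split_paired_All)

lemma ptrace_fst_X_op: "ptrace_fst (X_op a b c d x y) = diag2 (a + c) (b + d)"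
  by (simp add: ptrace_fst_def X_op_def diag2_def vec_eq_iff forall_qubit sum_qubit)

lemma mat_qubit: "mat (complex_of_real c) = diag2 c c"
  by (simp add: diag2_def vec_eq_iff mat_nth)

lemma diag2_diff: "diag2 a b - diag2 a' b' = diag2 (a - a') (b - b')"
  by (simp add: diag2_def vec_eq_iff)

section \<open>The amplitude damping channel\<close>

text \<open>The choice \<gamma> = 3/4 makes sqrt(1 - \<gamma>) = 1/2, and sqrt \<gamma> enters only
  squared, so all coefficients are rational.\<close>

lemma AD_nth:
  "AD_channel (3 / 4) X $ k $ l =
    (if k = 0 then if l = 0 then X $ 0 $ 0 + 3 / 4 * X $ 1 $ 1 else X $ 0 $ 1 / 2
     else if l = 0 then X $ 1 $ 0 / 2 else X $ 1 $ 1 / 4)"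
proof -
  have "sqrt (1 / 4) = 1 / (2 :: real)" by (simp add: real_sqrt_divide)
  then have s: "sqrt (1 - 3 / 4) = 1 / (2 :: real)" by simp
  have t: "complex_of_real (sqrt (3 / 4)) * complex_of_real (sqrt (3 / 4)) = 3 / 4"
    unfolding of_real_mult[symmetric] by simp
  show ?thesis
    unfolding AD_channel_def Let_def s
    by (simp add: matrix_matrix_mult_def sum_qubit ket_def axis_def dagger_def t mult.assoc mult.left_commute mult.commute)
qed

lemma AD_linear: "op_linear (AD_channel (3 / 4))"
  unfolding op_linear_def vec_eq_iff by (simp add: AD_nth algebra_simps add_divide_distrib)

lemma AD_trace_preserving: "trace_preserving (AD_channel (3 / 4))"
  by (simp add: trace_preserving_def trace_def sum_qubit AD_nth)

text \<open>The two Kraus operators give J as the unnormalised projector on |00> + |11>/2 plus 3/4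
  times the projector on |10>.\<close>

lemma trace_choi_AD:
  "trace (choi (AD_channel (3 / 4)) ** F) = F $ (0, 0) $ (0, 0) + F $ (1, 1) $ (1, 1) / 4 +
     F $ (0, 0) $ (1, 1) / 2 + F $ (1, 1) $ (0, 0) / 2 + 3 / 4 * F $ (1, 0) $ (1, 0)"
  by (simp add: trace_def matrix_matrix_mult_def sum_prod_UNIV sum_qubit choi_nth AD_nth ket_def axis_def)

text \<open>Here \<open>G = \<rho> \<otimes> 1 - F\<close>; only the diagonal of \<open>Tr\<^sub>A G = (1 - \<eta>) 1\<close> is needed.\<close>
lemma code_rates_complement:
  fixes N :: "2 op \<Rightarrow> 2 op"
  assumes "\<eta> \<in> code_rates ppt N \<epsilon>" and N: "op_linear N" "trace_preserving N"
  obtains G where "psd G" "ppt \<Longrightarrow> psd (ptranspose_snd G)" "Re (trace (choi N ** G)) \<le> \<epsilon>"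
    "Re (G $ (0, 0) $ (0, 0)) + Re (G $ (1, 0) $ (1, 0)) = 1 - \<eta>"
    "Re (G $ (0, 1) $ (0, 1)) + Re (G $ (1, 1) $ (1, 1)) = 1 - \<eta>"
proof -
  obtain F :: "(2 \<times> 2) op" and \<rho> where F: "trace \<rho> = 1" "F \<in> code_ops ppt N \<epsilon> \<rho>"
      "ptrace_fst F = mat (complex_of_real \<eta>)"
    using assms(1) by (auto simp: code_rates_def)
  define G where "G = \<rho> \<otimes>\<^sub>o mat 1 - F"
  have "ptrace_fst G = mat 1 - mat (complex_of_real \<eta>)"
    using ptrace_fst_tensor[of \<rho> "mat 1 :: 2 op"] F
    by (simp add: G_def ptrace_fst_def vec_eq_iff sum_subtractf)
  then have pt: "ptrace_fst G $ k $ k = 1 - of_real \<eta>" for k by (simp add: mat_nth)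
  have pG: "ptranspose_snd G = \<rho> \<otimes>\<^sub>o mat 1 - ptranspose_snd F"
    using ptranspose_tensor_one[of \<rho>] by (simp add: G_def vec_eq_iff)
  show thesis
  proof (rule that[of G])
    show "psd G" "ppt \<Longrightarrow> psd (ptranspose_snd G)"
      unfolding pG using F by (auto simp: code_ops_def G_def)
    show "Re (trace (choi N ** G)) \<le> \<epsilon>"
      using F by (simp add: G_def code_ops_def matrix_mult_diff_right trace_sub trace_choi_tensor_one N)
  qed (use pt[of 0, THEN arg_cong[where f = Re]] pt[of 1, THEN arg_cong[where f = Re]] in
        \<open>simp_all add: ptrace_fst_def sum_qubit\<close>)
qed

lemma hermitian_entry: "Re (X $ i $ j) = Re (X $ j $ i)" if "psd X"
proof -
  have "X $ i $ j = cnj (X $ j $ i)"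
    using arg_cong[OF psd_hermitian[OF that], of "\<lambda>Y. Y $ i $ j"] by (simp add: dagger_def)
  then show ?thesis by simp
qed

lemma psd_Re_minor: "(Re (X $ i $ j))\<^sup>2 \<le> Re (X $ i $ i) * Re (X $ j $ j)" if "psd X"
  using psd_minor[OF that, of i j] power_mono[OF abs_Re_le_cmod, of "X $ i $ j" 2] by simp

lemma psd_Re_diag: "0 \<le> Re (X $ i $ i)" if "psd X"
  using psd_diag[OF that, of i] by (simp add: less_eq_complex_def)

lemma AM_GM_weighted:
  fixes a b g h x :: real
  assumes "0 \<le> g" "0 \<le> h" "x\<^sup>2 \<le> g * h" "0 \<le> a" "0 \<le> b"
  shows "2 * a * b * \<bar>x\<bar> \<le> a\<^sup>2 * g + b\<^sup>2 * h"
proof -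
  have "(2 * a * b * \<bar>x\<bar>)\<^sup>2 \<le> 4 * (a\<^sup>2 * b\<^sup>2) * (g * h)"
    using assms by (simp add: power_mult_distrib mult_left_mono)
  also have "\<dots> \<le> (a\<^sup>2 * g + b\<^sup>2 * h)\<^sup>2"
    using zero_le_power2[of "a\<^sup>2 * g - b\<^sup>2 * h"] by (simp add: power2_eq_square algebra_simps)
  finally show ?thesis by (rule power2_le_imp_le) (use assms in simp)
qed

text \<open>The equality case of the weighted inequality: the hypotheses leave only (a^2 g - b^2
  h)^2 \<le> 0. It yields the diagonal ratio of a positive operator that annihilates a given vector
  of a plane.\<close>

lemma AM_GM_weighted_eq:
  fixes a b g h x :: real
  assumes "x\<^sup>2 \<le> g * h" "0 \<le> a\<^sup>2 * g + b\<^sup>2 * h" "a\<^sup>2 * g + b\<^sup>2 * h \<le> 2 * a * b * x"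
  shows "a\<^sup>2 * g = b\<^sup>2 * h"
proof -
  have "(a\<^sup>2 * g + b\<^sup>2 * h)\<^sup>2 \<le> (2 * a * b * x)\<^sup>2" using assms by (intro power_mono)
  also have "\<dots> = 4 * (a\<^sup>2 * b\<^sup>2) * x\<^sup>2" by (simp add: power_mult_distrib)
  also have "\<dots> \<le> 4 * (a\<^sup>2 * b\<^sup>2) * (g * h)" using assms(1) by (intro mult_left_mono) auto
  finally have "(a\<^sup>2 * g - b\<^sup>2 * h)\<^sup>2 \<le> 0" by (simp add: power2_eq_square algebra_simps)
  then show ?thesis by simp
qed

text \<open>At error zero G annihilates |10> and |00> + |11>/2, so k = 0 and h = 4 g. Equal
  marginals read g = m + h \<ge> 4 g, hence g = 0 and \<eta> = 1.\<close>

lemma AD_NS_rate: "1 \<le> \<eta>" if \<eta>: "\<eta> \<in> code_rates False (AD_channel (3 / 4)) 0"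
proof -
  obtain G where G: "psd G" "Re (trace (choi (AD_channel (3 / 4)) ** G)) \<le> 0"
    "Re (G $ (0, 0) $ (0, 0)) + Re (G $ (1, 0) $ (1, 0)) = 1 - \<eta>"
    "Re (G $ (0, 1) $ (0, 1)) + Re (G $ (1, 1) $ (1, 1)) = 1 - \<eta>"
    using code_rates_complement[OF \<eta> AD_linear AD_trace_preserving] by metis
  define g h x k m where "g = Re (G $ (0, 0) $ (0, 0))" and "h = Re (G $ (1, 1) $ (1, 1))"
    and "x = Re (G $ (0, 0) $ (1, 1))" and "k = Re (G $ (1, 0) $ (1, 0))" and "m = Re (G $ (0, 1) $ (0, 1))"
  note defs = this
  have le: "g + h / 4 + x + 3 / 4 * k \<le> 0" "g + k = 1 - \<eta>" "m + h = 1 - \<eta>"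
    using G(2-4) hermitian_entry[OF G(1), of "(1, 1)" "(0, 0)"] by (simp_all add: trace_choi_AD defs)
  have nn: "0 \<le> g" "0 \<le> h" "0 \<le> k" "0 \<le> m" "x\<^sup>2 \<le> g * h"
    using psd_Re_diag[OF G(1)] psd_Re_minor[OF G(1)] by (simp_all add: defs)
  have "2 * 1 * (1 / 2) * \<bar>x\<bar> \<le> 1\<^sup>2 * g + (1 / 2)\<^sup>2 * h" using nn by (intro AM_GM_weighted) auto
  then have "\<bar>x\<bar> \<le> g + h / 4" by (simp add: power2_eq_square)
  then have k: "k = 0" using le nn by linarith
  have "1\<^sup>2 * g = (1 / 2)\<^sup>2 * h"
    using nn le by (intro AM_GM_weighted_eq[of "- x"]) (auto simp: power2_eq_square)
  then have "g = h / 4" by (simp add: power2_eq_square)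
  then show ?thesis using k le nn by linarith
qed

text \<open>With \<epsilon> = 3/400, positivity of G gives 3k/4 \<le> \<epsilon>. Positivity of its
  partial transpose, with m \<le> 1 - \<eta>, gives 3(1 - \<eta>)/4 \<le> \<epsilon> + 5k/4.
  Together 1 - \<eta> \<le> 32 \<epsilon>/9 = 2/75.\<close>

lemma AD_PPT_rate: "73 / 75 \<le> \<eta>" if \<eta>: "\<eta> \<in> code_rates True (AD_channel (3 / 4)) (3 / 400)"
proof -
  obtain G where G: "psd G" "psd (ptranspose_snd G)" "Re (trace (choi (AD_channel (3 / 4)) ** G)) \<le> 3 / 400"
    "Re (G $ (0, 0) $ (0, 0)) + Re (G $ (1, 0) $ (1, 0)) = 1 - \<eta>"
    "Re (G $ (0, 1) $ (0, 1)) + Re (G $ (1, 1) $ (1, 1)) = 1 - \<eta>"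
    using code_rates_complement[OF \<eta> AD_linear AD_trace_preserving] by metis
  define g h x k m where "g = Re (G $ (0, 0) $ (0, 0))" and "h = Re (G $ (1, 1) $ (1, 1))"
    and "x = Re (G $ (0, 0) $ (1, 1))" and "k = Re (G $ (1, 0) $ (1, 0))" and "m = Re (G $ (0, 1) $ (0, 1))"
  note defs = this
  have le: "g + h / 4 + x + 3 / 4 * k \<le> 3 / 400" "g + k = 1 - \<eta>" "m + h = 1 - \<eta>"
    using G(3-5) hermitian_entry[OF G(1), of "(1, 1)" "(0, 0)"] by (simp_all add: trace_choi_AD defs)
  have nn: "0 \<le> g" "0 \<le> h" "0 \<le> k" "0 \<le> m" "x\<^sup>2 \<le> g * h"
    using psd_Re_diag[OF G(1)] psd_Re_minor[OF G(1)] by (simp_all add: defs)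
  have "x\<^sup>2 \<le> m * k" using psd_Re_minor[OF G(2), of "(0, 1)" "(1, 0)"] by (simp add: defs)
  then have "2 * (1 / 2) * 1 * \<bar>x\<bar> \<le> (1 / 2)\<^sup>2 * m + 1\<^sup>2 * k" using nn by (intro AM_GM_weighted) auto
  moreover have "2 * 1 * (1 / 2) * \<bar>x\<bar> \<le> 1\<^sup>2 * g + (1 / 2)\<^sup>2 * h" using nn by (intro AM_GM_weighted) auto
  ultimately have "\<bar>x\<bar> \<le> m / 4 + k" "\<bar>x\<bar> \<le> g + h / 4" by (simp_all add: power2_eq_square)
  then show ?thesis using le nn by linarith
qed

lemma AD_NS_strict: "C_NS (AD_channel (3 / 4)) 0 < R_E (AD_channel (3 / 4)) 0"
  unfolding C_NS_eq R_E_eq[OF AD_linear]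
proof (rule capacity_less_R_div[OF AD_linear AD_trace_preserving _ diag2_half_density _ _ AD_NS_rate])
  \<comment> \<open>The complement of \<open>?F\<close> is 1/10 times the unnormalised projector on
    |00> - 2|11>, which J annihilates; 1/10 is the largest factor keeping \<open>?F\<close>
    positive. The complement has marginal diag(1/10, 2/5), whence 9/10.\<close>
  let ?F = "X_op (2 / 5) (1 / 2) (1 / 2) (1 / 10) (1 / 5) 0"
  show "?F \<in> code_ops False (AD_channel (3 / 4)) 0 (diag2 (1 / 2) (1 / 2))"
    by (auto simp: code_ops_def diag2_tensor_one X_op_diff power2_eq_square intro!: psd_X_op)
       (simp add: trace_choi_AD X_op_def)
  show "psd (mat (complex_of_real (9 / 10)) - ptrace_fst ?F)"
    unfolding mat_qubit ptrace_fst_X_op diag2_diff by (rule psd_diag2) auto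
qed auto

lemma AD_PPT_strict: "C_NS_PPT (AD_channel (3 / 4)) (3 / 400) < R_E_PPT (AD_channel (3 / 4)) (3 / 400)"
  unfolding C_NS_PPT_eq R_E_PPT_eq[OF AD_linear]
proof (rule capacity_less_R_div[OF AD_linear AD_trace_preserving _ diag2_half_density _ _ AD_PPT_rate])
  \<comment> \<open>The complement is 1/40 times the unnormalised projector on |00> - 2|11>, free of
    error, plus k = 1/100 on |10>, which costs exactly 3/400, plus m = 1/4 on |01>, which makes m k
    equal to the squared coherence 1/400. The smaller marginal entry 1/40 + 1/100 = 7/200 exceeds
    2/75.\<close>
  let ?F = "X_op (19 / 40) (1 / 4) (49 / 100) (2 / 5) (1 / 20) 0"
  show "?F \<in> code_ops True (AD_channel (3 / 4)) (3 / 400) (diag2 (1 / 2) (1 / 2))"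
    by (auto simp: code_ops_def diag2_tensor_one X_op_diff ptranspose_X_op power2_eq_square intro!: psd_X_op)
       (simp add: trace_choi_AD X_op_def)
  show "psd (mat (complex_of_real (193 / 200)) - ptrace_fst ?F)"
    unfolding mat_qubit ptrace_fst_X_op diag2_diff by (rule psd_diag2) auto
qed auto

section \<open>The classical-quantum channel\<close>

text \<open>The Pythagorean choice a = 4/5, b = 3/5 keeps all entries rational, with unequal weights
  a^2 and b^2.\<close>

lemma cq_nth:
  "cq_channel (4 / 5) X $ k $ l =
    (if k = l then (if k = 0 then 16 / 25 else 9 / 25) * (X $ 0 $ 0 + X $ 1 $ 1)
     else 12 / 25 * (X $ 0 $ 0 - X $ 1 $ 1))"
proof -
  have "sqrt (9 / 25) = 3 / (5 :: real)" by (simp add: real_sqrt_divide)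
  then have s: "sqrt (1 - (4 / 5)\<^sup>2) = 3 / (5 :: real)" by (simp add: power2_eq_square)
  show ?thesis
    unfolding cq_channel_def Let_def s
    by (simp add: ket_def axis_def field_simps)
qed

lemma cq_linear: "op_linear (cq_channel (4 / 5))"
  unfolding op_linear_def vec_eq_iff by (simp add: cq_nth field_simps)

lemma cq_trace_preserving: "trace_preserving (cq_channel (4 / 5))"
  by (simp add: trace_preserving_def trace_def sum_qubit cq_nth field_simps)

lemma trace_choi_cq:
  "trace (choi (cq_channel (4 / 5)) ** F) =
    16 / 25 * (F $ (0, 0) $ (0, 0) + F $ (1, 0) $ (1, 0)) + 9 / 25 * (F $ (0, 1) $ (0, 1) + F $ (1, 1) $ (1, 1)) +
    12 / 25 * (F $ (0, 0) $ (0, 1) + F $ (0, 1) $ (0, 0) - F $ (1, 0) $ (1, 1) - F $ (1, 1) $ (1, 0))"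
  by (simp add: trace_def matrix_matrix_mult_def sum_prod_UNIV sum_qubit choi_nth cq_nth ket_def axis_def algebra_simps)

text \<open>At error zero the i-th diagonal block of G annihilates \<psi>_i, so its diagonal entries
  are in the ratio b^2 : a^2 = 9 : 16. Summed over i the two marginal entries have this ratio too;
  being equal, they vanish.\<close>

lemma cq_rate: "1 \<le> \<eta>" if \<eta>: "\<eta> \<in> code_rates ppt (cq_channel (4 / 5)) 0"
proof -
  obtain G where G: "psd G" "Re (trace (choi (cq_channel (4 / 5)) ** G)) \<le> 0"
    "Re (G $ (0, 0) $ (0, 0)) + Re (G $ (1, 0) $ (1, 0)) = 1 - \<eta>"
    "Re (G $ (0, 1) $ (0, 1)) + Re (G $ (1, 1) $ (1, 1)) = 1 - \<eta>"
    using code_rates_complement[OF \<eta> cq_linear cq_trace_preserving] by metis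
  define g h x where "g i = Re (G $ (i, 0) $ (i, 0))" and "h i = Re (G $ (i, 1) $ (i, 1))"
    and "x i = Re (G $ (i, 0) $ (i, 1))" for i
  have le: "16 / 25 * (g 0 + g 1) + 9 / 25 * (h 0 + h 1) + 24 / 25 * (x 0 - x 1) \<le> 0"
    using G(2) hermitian_entry[OF G(1), of "(0, 1)" "(0, 0)"] hermitian_entry[OF G(1), of "(1, 1)" "(1, 0)"]
    by (simp add: trace_choi_cq g_def h_def x_def)
  have nn: "0 \<le> g i" "0 \<le> h i" "(x i)\<^sup>2 \<le> g i * h i" for i
    using psd_Re_diag[OF G(1)] psd_Re_minor[OF G(1)] by (simp_all add: g_def h_def x_def)
  have "2 * (4 / 5) * (3 / 5) * \<bar>x i\<bar> \<le> (4 / 5)\<^sup>2 * g i + (3 / 5)\<^sup>2 * h i" for i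
    using nn[of i] by (intro AM_GM_weighted) auto
  then have "24 / 25 * \<bar>x i\<bar> \<le> 16 / 25 * g i + 9 / 25 * h i" for i by (simp add: power2_eq_square)
  then have ge: "24 / 25 * x i \<le> 16 / 25 * g i + 9 / 25 * h i \<and>
      24 / 25 * (- x i) \<le> 16 / 25 * g i + 9 / 25 * h i" for i
    by (meson abs_ge_self abs_ge_minus_self mult_left_mono order_trans zero_le_divide_iff zero_le_numeral)
  \<comment> \<open>Both inputs contribute nonnegatively to an error that is at most zero, so
    dropping one contribution bounds the other.\<close>
  have le0: "16 / 25 * g 0 + 9 / 25 * h 0 \<le> 24 / 25 * (- x 0)"
    using conjunct1[OF ge[of 1]] le by (simp add: field_simps)
  have le1: "16 / 25 * g 1 + 9 / 25 * h 1 \<le> 24 / 25 * x 1"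
    using conjunct2[OF ge[of 0]] le by (simp add: field_simps)
  have "(4 / 5)\<^sup>2 * g 0 = (3 / 5)\<^sup>2 * h 0"
    using nn[of 0] le0 by (intro AM_GM_weighted_eq[of "- x 0"]) (auto simp: power2_eq_square)
  moreover have "(4 / 5)\<^sup>2 * g 1 = (3 / 5)\<^sup>2 * h 1"
    using nn[of 1] le1 by (intro AM_GM_weighted_eq[of "x 1"]) (auto simp: power2_eq_square)
  ultimately have "16 * (g 0 + g 1) = 9 * (h 0 + h 1)" by (simp add: power2_eq_square)
  then have "16 * (1 - \<eta>) = 9 * (1 - \<eta>)" using G(3,4) by (simp only: g_def h_def)
  then show ?thesis by simp
qed

lemma cq_strict: "neg_log2 (Inf (code_rates ppt (cq_channel (4 / 5)) 0)) < R_div ppt (cq_channel (4 / 5)) 0"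
proof (rule capacity_less_R_div[OF cq_linear cq_trace_preserving _ diag2_half_density _ _ cq_rate])
  define e :: "2 \<Rightarrow> real \<Rightarrow> real \<Rightarrow> complex ^ (2 \<times> 2)" where
    "e i a b = (\<chi> p. if fst p = i then of_real (if snd p = 0 then a else b) else 0)" for i a b
  define P :: "real \<Rightarrow> real \<Rightarrow> (2 \<times> 2) op" where
    "P a b = op_scale (of_real (1 / 2)) (ketbra (e 0 a b) (e 0 a b) + ketbra (e 1 a (- b)) (e 1 a (- b)))" for a b
  have psdP: "psd (P a b)" for a b
    unfolding P_def by (intro psd_scale psd_add psd_ketbra) simp
  \<comment> \<open>Half the sum of |i><i| \<otimes> |\<psi>_i><\<psi>_i|. Its complement replaces
    \<psi>_i by the orthogonal unit vector, the blocks are real symmetric and so fixed by partial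
    transposition, and the coherences cancel in the marginal diag(16/25, 9/25).\<close>
  let ?F = "P (4 / 5) (3 / 5)"
  have compl: "diag2 (1 / 2) (1 / 2) \<otimes>\<^sub>o mat 1 - ?F = P (3 / 5) (- 4 / 5)"
    by (simp add: P_def e_def vec_eq_iff split_paired_All forall_qubit diag2_def mat_nth)
  have pt: "ptranspose_snd ?F = ?F"
    by (simp add: P_def e_def vec_eq_iff split_paired_All forall_qubit)
  show "?F \<in> code_ops ppt (cq_channel (4 / 5)) 0 (diag2 (1 / 2) (1 / 2))"
    by (simp add: code_ops_def pt compl psdP) (simp add: trace_choi_cq P_def e_def)
  have "ptrace_fst ?F = diag2 (16 / 25) (9 / 25)"
    by (simp add: P_def e_def vec_eq_iff ptrace_fst_def diag2_def forall_qubit sum_qubit)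
  then show "psd (mat (complex_of_real (16 / 25)) - ptrace_fst ?F)"
    unfolding mat_qubit by (simp add: diag2_diff psd_diag2)
qed auto

section \<open>Bounds, attained extrema and the four strict examples\<close>

theorem proposition6:
  shows
    "(\<forall>(N :: 'a::finite op \<Rightarrow> 'b::finite op) \<epsilon>.
        quantum_channel N \<and> 0 \<le> \<epsilon> \<and> \<epsilon> < 1 \<longrightarrow>
          C_NS N \<epsilon> \<le> R_E N \<epsilon> \<and>
          is_maxmin density_ops density_ops
            (\<lambda>\<rho> \<sigma>. D_H \<epsilon> (id_tensor N (purif \<rho>)) (ptrace_snd (purif \<rho>) \<otimes>\<^sub>o \<sigma>))
            (R_E N \<epsilon>) \<and>
          C_NS_PPT N \<epsilon> \<le> R_E_PPT N \<epsilon> \<and>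
          is_maxmin density_ops density_ops
            (\<lambda>\<rho> \<sigma>. D_H_PPT \<epsilon> (id_tensor N (purif \<rho>)) (ptrace_snd (purif \<rho>) \<otimes>\<^sub>o \<sigma>))
            (R_E_PPT N \<epsilon>)) \<and>
     (\<exists>\<gamma> \<epsilon>. 0 \<le> \<gamma> \<and> \<gamma> \<le> 1 \<and> 0 \<le> \<epsilon> \<and> \<epsilon> < 1 \<and>
        C_NS (AD_channel \<gamma>) \<epsilon> < R_E (AD_channel \<gamma>) \<epsilon>) \<and>
     (\<exists>\<gamma> \<epsilon>. 0 \<le> \<gamma> \<and> \<gamma> \<le> 1 \<and> 0 \<le> \<epsilon> \<and> \<epsilon> < 1 \<and>
        C_NS_PPT (AD_channel \<gamma>) \<epsilon> < R_E_PPT (AD_channel \<gamma>) \<epsilon>) \<and>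
     (\<exists>a \<epsilon>. a\<^sup>2 \<le> 1 \<and> sqrt (1 - a\<^sup>2) \<le> a \<and> 0 \<le> \<epsilon> \<and> \<epsilon> < 1 \<and>
        C_NS (cq_channel a) \<epsilon> < R_E (cq_channel a) \<epsilon>) \<and>
     (\<exists>a \<epsilon>. a\<^sup>2 \<le> 1 \<and> sqrt (1 - a\<^sup>2) \<le> a \<and> 0 \<le> \<epsilon> \<and> \<epsilon> < 1 \<and>
        C_NS_PPT (cq_channel a) \<epsilon> < R_E_PPT (cq_channel a) \<epsilon>)"
proof (intro conjI allI impI)
  fix N :: "'a op \<Rightarrow> 'b op" and \<epsilon> :: real
  assume *: "quantum_channel N \<and> 0 \<le> \<epsilon> \<and> \<epsilon> < 1"
  then have N: "op_linear N" "trace_preserving N" "0 \<le> \<epsilon>"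
    by (simp_all add: quantum_channel_def op_linear_def trace_preserving_def)
  show "C_NS N \<epsilon> \<le> R_E N \<epsilon>"
    unfolding C_NS_eq R_E_eq[OF N(1)] by (rule capacity_le_R_div[OF N])
  show "C_NS_PPT N \<epsilon> \<le> R_E_PPT N \<epsilon>"
    unfolding C_NS_PPT_eq R_E_PPT_eq[OF N(1)] by (rule capacity_le_R_div[OF N])
  show "is_maxmin density_ops density_ops
      (\<lambda>\<rho> \<sigma>. D_H \<epsilon> (id_tensor N (purif \<rho>)) (ptrace_snd (purif \<rho>) \<otimes>\<^sub>o \<sigma>)) (R_E N \<epsilon>)"
    by (subst is_maxmin_cong[where f' = "test_div False N \<epsilon>"])
      (auto simp: density_ops_def[where 'n = 'a] D_H_eq R_E_eq N is_maxmin_test_div[OF N, unfolded density_ops_def[where 'n = 'a]])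
  show "is_maxmin density_ops density_ops
      (\<lambda>\<rho> \<sigma>. D_H_PPT \<epsilon> (id_tensor N (purif \<rho>)) (ptrace_snd (purif \<rho>) \<otimes>\<^sub>o \<sigma>)) (R_E_PPT N \<epsilon>)"
    by (subst is_maxmin_cong[where f' = "test_div True N \<epsilon>"])
      (auto simp: density_ops_def[where 'n = 'a] D_H_PPT_eq R_E_PPT_eq N is_maxmin_test_div[OF N, unfolded density_ops_def[where 'n = 'a]])
next
  show "\<exists>\<gamma> \<epsilon>. 0 \<le> \<gamma> \<and> \<gamma> \<le> 1 \<and> 0 \<le> \<epsilon> \<and> \<epsilon> < 1 \<and>
      C_NS (AD_channel \<gamma>) \<epsilon> < R_E (AD_channel \<gamma>) \<epsilon>"
    using AD_NS_strict by (intro exI[of _ "3 / 4"] exI[of _ 0]) simp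
  show "\<exists>\<gamma> \<epsilon>. 0 \<le> \<gamma> \<and> \<gamma> \<le> 1 \<and> 0 \<le> \<epsilon> \<and> \<epsilon> < 1 \<and>
      C_NS_PPT (AD_channel \<gamma>) \<epsilon> < R_E_PPT (AD_channel \<gamma>) \<epsilon>"
    using AD_PPT_strict by (intro exI[of _ "3 / 4"] exI[of _ "3 / 400"]) simp
  have a: "(4 / 5)\<^sup>2 \<le> (1 :: real)" "sqrt (1 - (4 / 5)\<^sup>2) \<le> (4 / 5 :: real)"
    by (simp add: power2_eq_square) (rule real_le_lsqrt; simp add: power2_eq_square)
  show "\<exists>a \<epsilon>. a\<^sup>2 \<le> 1 \<and> sqrt (1 - a\<^sup>2) \<le> a \<and> 0 \<le> \<epsilon> \<and> \<epsilon> < 1 \<and>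
      C_NS (cq_channel a) \<epsilon> < R_E (cq_channel a) \<epsilon>"
    using a cq_strict[of False] unfolding C_NS_eq[symmetric] R_E_eq[OF cq_linear, symmetric]
    by (intro exI[of _ "4 / 5"] exI[of _ 0]) simp
  show "\<exists>a \<epsilon>. a\<^sup>2 \<le> 1 \<and> sqrt (1 - a\<^sup>2) \<le> a \<and> 0 \<le> \<epsilon> \<and> \<epsilon> < 1 \<and>
      C_NS_PPT (cq_channel a) \<epsilon> < R_E_PPT (cq_channel a) \<epsilon>"
    using a cq_strict[of True] unfolding C_NS_PPT_eq[symmetric] R_E_PPT_eq[OF cq_linear, symmetric]
    by (intro exI[of _ "4 / 5"] exI[of _ 0]) simp
qed

end
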